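(* Let $d=2$ and let $Q$ be a probability measure on $\Omega=\{0,1\}^{\mathbb{Z}^2}$ satisfying the standing assumptions (i) and (ii) of the context. Assume there exists a constant $C>0$ such that $$\sum_{k=N}^{\infty}\frac{k\cdot P(f_{e_i}=k)}{\mathbb{E}_P(f_{e_i})}\le\frac{C}{N}\qquad\text{for all } i\in\{1,2\}\text{ and all integers } N\ge 1 .$$ (This holds in particular whenever $\mathbb{E}_P(f_{e_i}^2)<\infty$ for $i\in\{1,2\}$.) Then the random walk $\{X_n\}_{n\ge 0}$ on the discrete point process is $\mathbb{P}$-almost surely recurrent, i.e. for $P$-almost every $\omega\in\Omega_0$, $P_\omega(X_n=0\text{ for infinitely many }n)=1$.
   Context: Setting. $\Omega=\{0,1\}^{\mathbb{Z}^d}$ (here $d=2$) with its Borel (product) $\sigma$-algebra $\mathfrak{B}$; for $x\in\mathbb{Z}^d$ the shift $\theta_x:\Omega\to\Omega$ is $(\theta_x\omega)(y)=\omega(x+y)$; $e_1,\dots,e_d$ are the standard basis vectors and $\mathcal{E}=\{\pm e_i\}_{i=1}^d$; $\mathcal{P}(\omega)=\{x\in\mathbb{Z}^d:\omega(x)=1\}$. Standing assumptions on $Q$: (i) $Q$ is stationary (invariant) and ergodic with respect to each single shift $\theta_{e_i}$, $i=1,\dots,d$; (ii) $Q(\mathcal{P}(\omega)=\emptyset)<1$. $\Omega_0=\{\omega\in\Omega:\omega(0)=1\}$ (it has positive $Q$-measure), $P=Q(\cdot\mid\Omega_0)$, and $\mathbb{E}_P$ is expectation under $P$. For $e\in\mathcal{E}$,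 $f_e(\omega)=\min\{k>0:\omega(ke)=1\}$ (almost surely finite). For $v\in\mathbb{Z}^d$, $N_v(\omega)=\{v+f_e(\theta_v\omega)e: e\in\mathcal{E}\}$ is the set of the $2d$ coordinate nearest neighbors of $v$, one in each of the $2d$ directions. Random walk. For $P$-a.e. $\omega\in\Omega_0$, the quenched law $P_\omega$ on $(\mathbb{Z}^d)^{\mathbb{N}}$ is the law of the Markov chain $\{X_n\}_{n\ge0}$ on $\mathcal{P}(\omega)$ with $X_0=0$ and $P_\omega(X_{n+1}=u\mid X_n=v)=\frac1{2d}$ if $u\in N_v(\omega)$ and $0$ otherwise. The annealed law is $\mathbb{P}(\cdot)=\int_{\Omega_0}P_\omega(\cdot)\,P(d\omega)$. *)

theory Defs
  imports "HOL-Probability.Probability"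
begin

text \<open>
  A configuration is a predicate on the lattice: \<open>\<omega> x\<close> holds iff \<open>\<omega>(x) = 1\<close>. For a countable
  index set and discrete fibres the product \<open>\<sigma>\<close>-algebra is the Borel one.
\<close>

type_synonym 'd config = "int ^ 'd \<Rightarrow> bool"

definition config_space :: "('d::finite) config measure" where
  "config_space = (\<Pi>\<^sub>M x\<in>UNIV. count_space UNIV)"

definition path_space :: "(nat \<Rightarrow> int ^ 'd::finite) measure" where
  "path_space = (\<Pi>\<^sub>M n\<in>UNIV. count_space UNIV)"

definition shift :: "int ^ 'd \<Rightarrow> ('d::finite) config \<Rightarrow> 'd config" where
  "shift x \<omega> = (\<lambda>y. \<omega> (x + y))"

definition unit_steps :: "(int ^ 'd::finite) set" where
  "unit_steps = (\<Union>i. {axis i 1, - axis i 1})"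

definition points :: "('d::finite) config \<Rightarrow> (int ^ 'd) set" where
  "points \<omega> = {x. \<omega> x}"

definition invariant_under :: "'a measure \<Rightarrow> ('a \<Rightarrow> 'a) \<Rightarrow> bool" where
  "invariant_under M T \<longleftrightarrow> T \<in> measurable M M \<and> distr M M T = M"

definition ergodic_under :: "'a measure \<Rightarrow> ('a \<Rightarrow> 'a) \<Rightarrow> bool" where
  "ergodic_under M T \<longleftrightarrow>
     (\<forall>A\<in>sets M. T -` A \<inter> space M = A \<longrightarrow> measure M A = 0 \<or> measure M A = 1)"

locale ergodic_point_process = prob_space Q for Q :: "('d::finite) config measure" +
  assumes sets_Q: "sets Q = sets config_space"
    and stationary: "\<And>i. invariant_under Q (shift (axis i 1))"
    and ergodic: "\<And>i. ergodic_under Q (shift (axis i 1))"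
    and not_as_empty: "\<P>(\<omega> in Q. points \<omega> = {}) < 1"

definition palm :: "('d::finite) config measure \<Rightarrow> 'd config measure" where
  "palm Q = uniform_measure Q {\<omega> \<in> space Q. \<omega> 0}"

text \<open>The value is \<open>\<infinity>\<close> if there is no point of \<open>\<omega>\<close> in direction \<open>e\<close>.\<close>

definition first_point :: "int ^ 'd \<Rightarrow> ('d::finite) config \<Rightarrow> enat" where
  "first_point e \<omega> = (INF k\<in>{k. 0 < k \<and> \<omega> (int k *s e)}. enat k)"

definition neighbours :: "('d::finite) config \<Rightarrow> int ^ 'd \<Rightarrow> (int ^ 'd) set" where
  "neighbours \<omega> v = {v + int k *s e | k e. e \<in> unit_steps \<and> first_point e (shift v \<omega>) = enat k}"

definition transition_prob :: "('d::finite) config \<Rightarrow> int ^ 'd \<Rightarrow> int ^ 'd \<Rightarrow> real" where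
  "transition_prob \<omega> v u = (if u \<in> neighbours \<omega> v then 1 / (2 * real CARD('d)) else 0)"

text \<open>
  \<open>embed_pmf\<close> returns the intended distribution exactly when the transition probabilities out
  of \<open>v\<close> sum to 1, that is, when \<open>v\<close> has a neighbour in each of the \<open>2d\<close> directions
  (lemma \<open>pmf_step_pmf\<close> below). Almost surely this holds at every point of the process.
\<close>

definition step_pmf :: "('d::finite) config \<Rightarrow> int ^ 'd \<Rightarrow> (int ^ 'd) pmf" where
  "step_pmf \<omega> v = embed_pmf (transition_prob \<omega> v)"

lemma minus_axis: "- axis i (1::int) = axis i (-1)"
  by (simp add: vec_eq_iff axis_def)

lemma card_unit_steps: "card (unit_steps :: (int ^ 'd::finite) set) = 2 * CARD('d)"
proof -
  have ne: "axis i (1::int) \<noteq> - axis j 1" for i j :: 'd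
  proof
    assume "axis i (1::int) = - axis j 1"
    then have "axis i (1::int) $ i = (- axis j 1) $ i" by simp
    then show False by (simp add: axis_def split: if_splits)
  qed
  have "card (range (\<lambda>i. axis i (1::int) :: int ^ 'd)) = CARD('d)"
       "card (range (\<lambda>i. - axis i (1::int) :: int ^ 'd)) = CARD('d)"
    by (rule card_image, auto simp: inj_def axis_eq_axis)+
  moreover have "(unit_steps :: (int ^ 'd) set) = range (\<lambda>i. axis i 1) \<union> range (\<lambda>i. - axis i 1)"
    by (auto simp: unit_steps_def)
  moreover have "range (\<lambda>i. axis i (1::int) :: int ^ 'd) \<inter> range (\<lambda>i. - axis i 1) = {}"
    using ne by auto
  ultimately show ?thesis
    by (metis card_Un_disjoint finite_imageI finite_class.finite_UNIV mult_2)
qed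

lemma card_neighbours:
  fixes \<omega> :: "('d::finite) config"
  assumes fin: "\<And>e. e \<in> unit_steps \<Longrightarrow> first_point e (shift v \<omega>) \<noteq> \<infinity>"
  shows "card (neighbours \<omega> v) = 2 * CARD('d)"
proof -
  define g where "g e = the_enat (first_point e (shift v \<omega>))" for e
  have g: "first_point e (shift v \<omega>) = enat (g e)" if "e \<in> unit_steps" for e
    using fin[OF that] by (auto simp: g_def)
  have pos: "0 < g e" if "e \<in> unit_steps" for e
  proof -
    have "1 \<le> first_point e (shift v \<omega>)"
      unfolding first_point_def by (rule INF_greatest) (auto simp: one_enat_def)
    then show ?thesis using g[OF that] by (simp add: one_enat_def)
  qed
  have "neighbours \<omega> v = (\<lambda>e. v + int (g e) *s e) ` unit_steps"
    unfolding neighbours_def using g by fastforce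
  moreover have "inj_on (\<lambda>e. v + int (g e) *s e) unit_steps"
  proof (rule inj_onI)
    fix e e' :: "int ^ 'd"
    assume e: "e \<in> unit_steps" "e' \<in> unit_steps"
      and eq: "v + int (g e) *s e = v + int (g e') *s e'"
    have c: "int (g e) * e $ i = int (g e') * e' $ i" for i
      using eq by (metis add_left_cancel vector_smult_component)
    from e obtain i j s t where *: "e = axis i s" "e' = axis j t" "s \<in> {1, -1}" "t \<in> {1, -1}"
      using that unfolding unit_steps_def minus_axis by blast
    show "e = e'"
      using c[of i] c[of j] * pos[OF e(1)] pos[OF e(2)]
      by (auto simp: axis_def split: if_splits)
  qed
  ultimately show ?thesis by (simp add: card_image card_unit_steps)
qed

lemma pmf_step_pmf:
  assumes "\<And>e. e \<in> unit_steps \<Longrightarrow> first_point e (shift v \<omega>) \<noteq> \<infinity>"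
  shows "pmf (step_pmf \<omega> v) u = transition_prob \<omega> v u"
proof -
  have c: "card (neighbours \<omega> v) = 2 * CARD('a)" by (rule card_neighbours[OF assms])
  then have "finite (neighbours \<omega> v)" by (intro card_ge_0_finite) simp
  moreover have "ennreal (transition_prob \<omega> v x) =
      ennreal (1 / (2 * real CARD('a))) * indicator (neighbours \<omega> v) x" for x
    by (simp add: transition_prob_def indicator_def)
  moreover have "ennreal (1 / (2 * real CARD('a))) * of_nat (2 * CARD('a)) = 1"
    by (subst ennreal_of_nat_eq_real_of_nat, subst ennreal_mult[symmetric]) auto
  ultimately show ?thesis
    unfolding step_pmf_def
    by (intro pmf_embed_pmf) (auto simp: transition_prob_def nn_integral_cmult_indicator c)
qed

text \<open>
  The Ionescu-Tulcea kernel for time \<open>n\<close>, given the history \<open>x 0, \<dots>, x (n - 1)\<close>.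
\<close>

definition walk_kernel ::
  "('d::finite) config \<Rightarrow> nat \<Rightarrow> (nat \<Rightarrow> int ^ 'd) \<Rightarrow> (int ^ 'd) measure" where
  "walk_kernel \<omega> n x =
     measure_pmf (case n of 0 \<Rightarrow> return_pmf 0 | Suc m \<Rightarrow> step_pmf \<omega> (x m))"

definition quenched_law :: "('d::finite) config \<Rightarrow> (nat \<Rightarrow> int ^ 'd) measure" where
  "quenched_law \<omega> =
     projective_family.lim UNIV
       (Ionescu_Tulcea.CI (walk_kernel \<omega>) (\<lambda>_. count_space UNIV)) (\<lambda>_. count_space UNIV)"

lemma Ionescu_Tulcea_walk: "Ionescu_Tulcea (walk_kernel \<omega>) (\<lambda>_. count_space UNIV)"
proof (rule Ionescu_Tulcea.intro)
  fix n
  show "walk_kernel \<omega> n \<in> measurable (\<Pi>\<^sub>M i\<in>{0..<n}. count_space UNIV) (subprob_algebra (count_space UNIV))"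
  proof (cases n)
    case 0
    then show ?thesis
      by (auto simp: walk_kernel_def[abs_def] intro!: measurable_const measure_pmf_in_subprob_algebra)
  next
    case (Suc m)
    have "(\<lambda>x. measure_pmf (step_pmf \<omega> (x m)))
        \<in> measurable (\<Pi>\<^sub>M i\<in>{0..<n}. count_space UNIV) (subprob_algebra (count_space UNIV))"
      by (rule measurable_compose[OF measurable_component_singleton[of m]])
         (auto simp: Suc intro!: measure_pmf_in_subprob_algebra)
    then show ?thesis by (simp add: walk_kernel_def[abs_def] Suc)
  qed
qed (simp add: walk_kernel_def measure_pmf.prob_space_axioms)

lemma sets_quenched_law: "sets (quenched_law \<omega>) = sets path_space"
proof -
  interpret Ionescu_Tulcea "walk_kernel \<omega>" "\<lambda>_. count_space UNIV" by (rule Ionescu_Tulcea_walk)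
  show ?thesis by (simp add: quenched_law_def path_space_def)
qed

lemma space_quenched_law: "space (quenched_law \<omega>) = UNIV"
  using sets_eq_imp_space_eq[OF sets_quenched_law[of \<omega>]] by (simp add: path_space_def space_PiM)

lemma emeasure_quenched_law_cylinder:
  "emeasure (quenched_law \<omega>) {X. \<forall>i\<le>n. X i = x i} =
     (if x 0 = 0 then \<Prod>i<n. ennreal (pmf (step_pmf \<omega> (x i)) (x (Suc i))) else 0)"
proof -
  interpret Ionescu_Tulcea "walk_kernel \<omega>" "\<lambda>_. count_space UNIV" by (rule Ionescu_Tulcea_walk)
  let ?M = "\<lambda>_::nat. count_space (UNIV :: (int ^ 'a) set)"
  let ?x = "\<lambda>n. restrict x {0..<n}"
  let ?u = "\<lambda>_::nat. undefined :: int ^ 'a"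
  have xin[simp]: "?x n \<in> space (PiM {0..<n} ?M)" for n by (simp add: space_PiM)
  have uin[simp]: "?u \<in> space (PiM {0..<0} ?M)" by (simp add: space_PiM PiE_def)
  have xs[measurable]: "{?x n} \<in> sets (PiM {0..<n} ?M)" for n
  proof -
    have "{?x n} = PiE {0..<n} (\<lambda>i. {x i})" by (auto simp: PiE_def extensional_def fun_eq_iff Pi_iff)
    also have "\<dots> \<in> sets (PiM {0..<n} ?M)" by (rule sets_PiM_I_finite) auto
    finally show ?thesis .
  qed
  have C: "emeasure (C 0 (Suc n) ?u) {?x (Suc n)} =
     (if x 0 = 0 then \<Prod>i<n. ennreal (pmf (step_pmf \<omega> (x i)) (x (Suc i))) else 0)" for n
  proof -
    have step: "emeasure (C 0 (Suc n) ?u) {?x (Suc n)} =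
        emeasure (walk_kernel \<omega> n (?x n)) {x n} * emeasure (C 0 n ?u) {?x n}" for n
    proof -
      have "emeasure (C 0 (Suc n) ?u) {?x (Suc n)} =
          (\<integral>\<^sup>+y. emeasure (eP n y) {?x (Suc n)} \<partial>C 0 n ?u)"
        by (simp, subst emeasure_bind[where N="PiM {0..<Suc n} ?M"])
           (auto simp: space_C measurable_cong_sets[OF sets_C])
      also have "\<dots> = (\<integral>\<^sup>+y. emeasure (walk_kernel \<omega> n (?x n)) {x n} * indicator {?x n} y \<partial>C 0 n ?u)"
      proof (rule nn_integral_cong)
        fix y assume "y \<in> space (C 0 n ?u)"
        then have y: "y \<in> space (PiM {0..<n} ?M)" by (simp add: space_C)
        then have ext: "y \<in> extensional {0..<n}" by (simp add: space_PiM PiE_def)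
        have "(y(n := z) = ?x (Suc n)) \<longleftrightarrow> y = ?x n \<and> z = x n" for z
        proof
          assume eq: "y(n := z) = ?x (Suc n)"
          have "y i = ?x n i" for i
            using fun_cong[OF eq, of i] ext
            by (cases "i < n") (auto simp: extensional_def split: if_splits)
          moreover have "z = x n" using fun_cong[OF eq, of n] by simp
          ultimately show "y = ?x n \<and> z = x n" by auto
        qed (auto simp: fun_eq_iff)
        then have "fun_upd y n -` {?x (Suc n)} = (if y = ?x n then {x n} else {})" by auto
        with y show "emeasure (eP n y) {?x (Suc n)} =
            emeasure (walk_kernel \<omega> n (?x n)) {x n} * indicator {?x n} y"
          by (auto simp: emeasure_eP)
      qed
      also have "\<dots> = emeasure (walk_kernel \<omega> n (?x n)) {x n} * emeasure (C 0 n ?u) {?x n}"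
        by (rule nn_integral_cmult_indicator) (simp add: sets_C)
      finally show ?thesis .
    qed
    show ?thesis
    proof (induction n)
      case 0
      have "?u \<in> {?x 0}" by (auto simp: restrict_def)
      then show ?case
        using xs[of 0]
        by (subst step) (auto simp: walk_kernel_def emeasure_pmf_single emeasure_return)
    next
      case (Suc n)
      have "emeasure (walk_kernel \<omega> (Suc n) (?x (Suc n))) {x (Suc n)} =
          ennreal (pmf (step_pmf \<omega> (x n)) (x (Suc n)))"
        by (simp add: walk_kernel_def emeasure_pmf_single)
      then show ?case
        unfolding step[of "Suc n"] Suc.IH by (simp add: mult.commute)
    qed
  qed
  have "{X. \<forall>i\<le>n. X i = x i} = PF.emb UNIV {0..<Suc n} {?x (Suc n)}"
    by (auto simp: prod_emb_def fun_eq_iff restrict_def less_Suc_eq_le split: if_splits)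
  then have "emeasure (quenched_law \<omega>) {X. \<forall>i\<le>n. X i = x i} = emeasure (CI {0..<Suc n}) {?x (Suc n)}"
    unfolding quenched_law_def by (simp only: lim[OF _ xs] finite_atLeastLessThan)
  also have "\<dots> = emeasure (C 0 (Suc n) ?u) (PF.emb {0..<Suc n} {0..<Suc n} {?x (Suc n)})"
    by (rule emeasure_CI) auto
  also have "PF.emb {0..<Suc n} {0..<Suc n} {?x (Suc n)} = {?x (Suc n)}"
    by (rule prod_emb_id) auto
  finally show ?thesis by (simp only: C)
qed

lemma prob_space_quenched_law: "prob_space (quenched_law \<omega>)"
proof
  interpret Ionescu_Tulcea "walk_kernel \<omega>" "\<lambda>_. count_space UNIV" by (rule Ionescu_Tulcea_walk)
  have "emeasure PF.lim (PF.emb UNIV {} (space (PiM {} (\<lambda>_. count_space UNIV)))) =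
      emeasure (CI {}) (space (PiM {} (\<lambda>_. count_space UNIV)))"
    by (rule lim) auto
  also have "\<dots> = 1"
    using prob_space.emeasure_space_1[OF PF.prob_space_P[of "{}"]] PF.space_P[of "{}"] by simp
  finally show "emeasure (quenched_law \<omega>) (space (quenched_law \<omega>)) = 1"
    unfolding space_quenched_law by (simp add: quenched_law_def prod_emb_def space_PiM vimage_def restrict_def)
qed

text \<open>
  Sums and expectations are taken in \<open>ennreal\<close>, so no summability or integrability side
  condition is hidden. The sum over \<open>k \<ge> N\<close> is written with \<open>k = N + j\<close>.
\<close>

definition mean_gap :: "('d::finite) config measure \<Rightarrow> 'd \<Rightarrow> ennreal" where
  "mean_gap Q i = (\<integral>\<^sup>+\<omega>. ennreal_of_enat (first_point (axis i 1) \<omega>) \<partial>palm Q)"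

definition gap_tail :: "('d::finite) config measure \<Rightarrow> 'd \<Rightarrow> nat \<Rightarrow> ennreal" where
  "gap_tail Q i N =
     (\<Sum>j. of_nat (N + j) *
        emeasure (palm Q) {\<omega> \<in> space (palm Q). first_point (axis i 1) \<omega> = enat (N + j)} /
        mean_gap Q i)"

definition gap_condition :: "('d::finite) config measure \<Rightarrow> bool" where
  "gap_condition Q \<longleftrightarrow>
     (\<exists>C::real. 0 < C \<and> (\<forall>i. \<forall>N\<ge>1. gap_tail Q i N \<le> ennreal (C / real N)))"

definition recurrent_walk :: "('d::finite) config \<Rightarrow> bool" where
  "recurrent_walk \<omega> \<longleftrightarrow> \<P>(X in quenched_law \<omega>. \<exists>\<^sub>\<infinity>n. X n = 0) = 1"

end

theory Submission
  imports Defs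
begin

text \<open>
  The walk is simple random walk on a symmetric 4-regular graph, so it is an average of four
  permutations of the lattice. For a finitely supported \<open>f\<close> with \<open>f 0 = 1\<close>, the Green function at
  the origin is at least a constant over the Dirichlet energy of \<open>f\<close>, so test functions of
  arbitrarily small energy give recurrence.

  One deterministic sequence of test functions works for almost every \<open>\<omega>\<close>. By stationarity its
  expected energy is \<open>\<Sum>k. q k * S k\<close> per direction, where \<open>q k\<close> is the probability that the origin is
  a point whose next gap has length \<open>k\<close>, and \<open>S k\<close> is the sum over the lattice of the squared
  increments of \<open>f\<close> over distance \<open>k\<close>. The gap condition bounds the tails of \<open>\<Sum>k. k * q k\<close> by \<open>C / N\<close>.
  Hence a tent of radius \<open>r\<close> has expected energy \<open>O(log r)\<close>; averaging the tents of radius \<open>2 ^ m\<close>,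
  \<open>m < M\<close>, with weights proportional to \<open>1 / (m + 1)\<close> gives expected energy \<open>O(1 / log M)\<close>.
\<close>

section \<open>The Markov property and last exits\<close>

text \<open>Edges have unbounded length, and the gap condition allows gaps of infinite variance;
  this is why the bound for one tent grows with its radius. Mixing scales helps because two tents of
  different size interact only through edges that meet the smaller square, which gains the ratio of
  the radii. Dyadic scales therefore barely interact, and since scale \<open>m\<close> costs about
  \<open>m + 1\<close>, the divergence of the harmonic series makes the averaged energy vanish.
  Energy is additive over edges, so its expectation sees only the law of a single gap; the
  dependence between gaps never enters. The passage from expectation to almost every \<omega> uses
  an infimum over the test functions: its integral is zero, so it vanishes almost everywhere, with
  the good test function depending on \<omega>. On the side of the walk everything rests on
  reversibility: stepping to the next point in direction \<open>e\<close> is undone by stepping in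
  direction \<open>- e\<close>. Sites outside the process are left fixed, so that the four steps
  become permutations of the whole lattice.\<close>

lemma sets_prefix_event:
  fixes E :: "(nat \<Rightarrow> int ^ 'd::finite) set"
  assumes "\<And>X Y. \<forall>i\<le>n. X i = Y i \<Longrightarrow> X \<in> E \<longleftrightarrow> Y \<in> E"
  shows "E \<in> sets (quenched_law \<omega>)"
proof -
  have coord: "(\<lambda>X. X i) \<in> measurable path_space (count_space (UNIV :: (int ^ 'd) set))" for i
    unfolding path_space_def by simp
  have cyl: "{X. map X [0..<Suc n] = map Y [0..<Suc n]} \<in> sets path_space"
    for Y :: "nat \<Rightarrow> int ^ 'd"
  proof -
    have "{X. map X [0..<Suc n] = map Y [0..<Suc n]}
        = (\<Inter>i\<in>{..n}. (\<lambda>X. X i) -` {Y i} \<inter> space path_space)"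
      by (auto simp: path_space_def space_PiM map_eq_conv simp del: upt_Suc)
    also have "\<dots> \<in> sets path_space"
      by (intro sets.finite_INT measurable_sets[OF coord]) auto
    finally show ?thesis .
  qed
  have "E = (\<Union>p\<in>(\<lambda>X. map X [0..<Suc n]) ` E. {X. map X [0..<Suc n] = p})"
  proof (intro set_eqI iffI)
    fix X assume "X \<in> (\<Union>p\<in>(\<lambda>X. map X [0..<Suc n]) ` E. {X. map X [0..<Suc n] = p})"
    then obtain Y where Y: "Y \<in> E" "map X [0..<Suc n] = map Y [0..<Suc n]" by blast
    then have "\<forall>i\<le>n. X i = Y i" by (simp add: map_eq_conv less_Suc_eq_le del: upt_Suc)
    then show "X \<in> E" using assms Y(1) by blast
  qed blast
  also have "\<dots> \<in> sets path_space"
    using cyl by (intro sets.countable_UN') auto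
  finally show ?thesis by (simp add: sets_quenched_law)
qed

text \<open>The Markov property at time \<open>n\<close>. The past splits into countably many
  cylinders, and prolonging a cylinder by one step multiplies its weight by one transition
  probability.\<close>

lemma emeasure_quenched_law_Suc:
  fixes E :: "(nat \<Rightarrow> int ^ 'd::finite) set"
  assumes E: "\<And>X Y. \<forall>i\<le>n. X i = Y i \<Longrightarrow> X \<in> E \<longleftrightarrow> Y \<in> E"
  shows "emeasure (quenched_law \<omega>) (E \<inter> {X. X n = x} \<inter> {X. X (Suc n) = y}) =
    emeasure (quenched_law \<omega>) (E \<inter> {X. X n = x}) * ennreal (pmf (step_pmf \<omega> x) y)"
proof -
  define S where "S = E \<inter> {X. X n = x}"
  \<comment> \<open>A prefix is coded as a list because lists over the lattice form a countable
    type, so events can be summed over prefixes.\<close>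
  define c where "c X = map X [0..<Suc n]" for X :: "nat \<Rightarrow> int ^ 'd"
  have c_eq: "c X = c Y \<longleftrightarrow> (\<forall>i\<le>n. X i = Y i)" for X Y
    by (auto simp: c_def map_eq_conv less_Suc_eq_le simp del: upt_Suc)
  have S: "X \<in> S \<longleftrightarrow> Y \<in> S" if "\<forall>i\<le>n. X i = Y i" for X Y
    using E[OF that] that by (auto simp: S_def)
  \<comment> \<open>The set \<open>A\<close> is left open to use the decomposition twice: with the
    next position fixed, and with \<open>A = UNIV\<close> to reassemble the past.\<close>
  have *: "emeasure (quenched_law \<omega>) (S \<inter> A) =
     (\<integral>\<^sup>+p. emeasure (quenched_law \<omega>) ({X. c X = p} \<inter> A) \<partial>count_space (c ` S))"
    if A: "\<And>X Y. \<forall>i\<le>Suc n. X i = Y i \<Longrightarrow> X \<in> A \<longleftrightarrow> Y \<in> A" for A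
  proof -
    have "S \<inter> A = (\<Union>p\<in>c ` S. {X. c X = p} \<inter> A)"
    proof (intro set_eqI iffI)
      fix X assume "X \<in> (\<Union>p\<in>c ` S. {X. c X = p} \<inter> A)"
      then obtain Y where Y: "Y \<in> S" "c X = c Y" "X \<in> A" by blast
      then show "X \<in> S \<inter> A" using S[of X Y] by (simp add: c_eq)
    qed blast
    moreover have "emeasure (quenched_law \<omega>) (\<Union>p\<in>c ` S. {X. c X = p} \<inter> A) =
        (\<integral>\<^sup>+p. emeasure (quenched_law \<omega>) ({X. c X = p} \<inter> A) \<partial>count_space (c ` S))"
    proof (rule emeasure_UN_countable)
      fix p
      show "{X. c X = p} \<inter> A \<in> sets (quenched_law \<omega>)"
      proof (rule sets_prefix_event[of "Suc n"])
        fix X Y :: "nat \<Rightarrow> int ^ 'd" assume XY: "\<forall>i\<le>Suc n. X i = Y i"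
        then have "c X = c Y" by (simp add: c_eq)
        then show "X \<in> {X. c X = p} \<inter> A \<longleftrightarrow> Y \<in> {X. c X = p} \<inter> A" using A[OF XY] by simp
      qed
    qed (auto simp: disjoint_family_on_def)
    ultimately show ?thesis by (simp only:)
  qed
  have cyl: "emeasure (quenched_law \<omega>) ({Z. c Z = p} \<inter> {Z. Z (Suc n) = y}) =
      emeasure (quenched_law \<omega>) {Z. c Z = p} * ennreal (pmf (step_pmf \<omega> x) y)"
    if p: "p \<in> c ` S" for p
  proof -
    obtain X where X: "X \<in> S" "p = c X" using p by auto
    let ?Y = "X(Suc n := y)"
    have "{Z. c Z = p} \<inter> {Z. Z (Suc n) = y} = {Z. \<forall>i\<le>Suc n. Z i = ?Y i}"
      by (auto simp: X c_eq le_Suc_eq)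
    moreover have "{Z. c Z = p} = {Z. \<forall>i\<le>n. Z i = X i}"
      by (auto simp: X c_eq)
    moreover have "(\<Prod>i<n. ennreal (pmf (step_pmf \<omega> (?Y i)) (?Y (Suc i)))) =
        (\<Prod>i<n. ennreal (pmf (step_pmf \<omega> (X i)) (X (Suc i))))"
      by (rule prod.cong) auto
    moreover have "X n = x" using X by (simp add: S_def)
    ultimately show ?thesis
      by (simp only: emeasure_quenched_law_cylinder prod.lessThan_Suc) auto
  qed
  have "emeasure (quenched_law \<omega>) (S \<inter> {X. X (Suc n) = y}) =
      (\<integral>\<^sup>+p. emeasure (quenched_law \<omega>) {Z. c Z = p} * ennreal (pmf (step_pmf \<omega> x) y) \<partial>count_space (c ` S))"
    by (subst *) (auto intro!: nn_integral_cong simp: cyl)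
  also have "\<dots> = emeasure (quenched_law \<omega>) (S \<inter> UNIV) * ennreal (pmf (step_pmf \<omega> x) y)"
    by (subst *) (auto simp: nn_integral_multc)
  finally show ?thesis by (simp add: S_def)
qed

lemma emeasure_quenched_law_partition:
  fixes E :: "(nat \<Rightarrow> int ^ 'd::finite) set"
  assumes "E \<in> sets (quenched_law \<omega>)"
  shows "emeasure (quenched_law \<omega>) (E \<inter> {X. X n \<in> A}) =
    (\<integral>\<^sup>+y. emeasure (quenched_law \<omega>) (E \<inter> {X. X n = y}) \<partial>count_space A)"
proof -
  have s: "{X. X n = y} \<in> sets (quenched_law \<omega>)" for y
    by (rule sets_prefix_event[of n]) auto
  have "E \<inter> {X. X n \<in> A} = (\<Union>y\<in>A. E \<inter> {X. X n = y})" by auto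
  moreover have "disjoint_family_on (\<lambda>y. E \<inter> {X. X n = y}) A"
    by (auto simp: disjoint_family_on_def)
  ultimately show ?thesis
    using emeasure_UN_countable[of A "\<lambda>y. E \<inter> {X. X n = y}"] assms s by simp
qed

text \<open>The chance, starting from \<open>x\<close>, of missing the origin at times
  \<open>1\<close> to \<open>m\<close>. The start itself is unconstrained, so the values at
  \<open>x = 0\<close> decrease to the escape probability.\<close>

primrec avoid_prob :: "('d::finite) config \<Rightarrow> nat \<Rightarrow> int ^ 'd \<Rightarrow> ennreal" where
  "avoid_prob \<omega> 0 x = 1"
| "avoid_prob \<omega> (Suc m) x = (\<integral>\<^sup>+y. ennreal (pmf (step_pmf \<omega> x) y) * avoid_prob \<omega> m y \<partial>count_space (- {0}))"

text \<open>The induction moves the step at time \<open>n + 1\<close> from the future into the past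
  event, which is why \<open>n\<close>, \<open>E\<close> and \<open>x\<close> all vary.\<close>

lemma emeasure_quenched_law_avoid:
  fixes E :: "(nat \<Rightarrow> int ^ 'd::finite) set"
  assumes E: "\<And>X Y. \<forall>i\<le>n. X i = Y i \<Longrightarrow> X \<in> E \<longleftrightarrow> Y \<in> E"
  shows "emeasure (quenched_law \<omega>) (E \<inter> {X. X n = x} \<inter> {X. \<forall>k. n < k \<and> k \<le> n + m \<longrightarrow> X k \<noteq> 0}) =
    emeasure (quenched_law \<omega>) (E \<inter> {X. X n = x}) * avoid_prob \<omega> m x"
  using E
proof (induction m arbitrary: n E x)
  case 0
  have "{X :: nat \<Rightarrow> int ^ 'd. \<forall>k. n < k \<and> k \<le> n + 0 \<longrightarrow> X k \<noteq> 0} = UNIV" by auto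
  then show ?case by (simp only: Int_UNIV_right avoid_prob.simps mult_1_right)
next
  case (Suc m)
  let ?A = "\<lambda>n m. {X :: nat \<Rightarrow> int ^ 'd. \<forall>k. n < k \<and> k \<le> n + m \<longrightarrow> X k \<noteq> 0}"
  let ?F = "E \<inter> {X. X n = x}"
  have F: "X \<in> ?F \<longleftrightarrow> Y \<in> ?F" if "\<forall>i\<le>Suc n. X i = Y i" for X Y
  proof -
    have "X \<in> E \<longleftrightarrow> Y \<in> E" by (rule Suc.prems) (use that in simp)
    moreover have "X n = Y n" using that by simp
    ultimately show ?thesis by (simp only: Int_iff mem_Collect_eq)
  qed
  have A: "?A n (Suc m) = ?A (Suc n) m \<inter> {X. X (Suc n) \<in> - {0}}"
  proof -
    have "n < k \<and> k \<le> n + Suc m \<longleftrightarrow> k = Suc n \<or> Suc n < k \<and> k \<le> Suc n + m" for k by linarith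
    then show ?thesis by (simp only: Compl_iff singleton_iff mem_Collect_eq set_eq_iff Int_iff) blast
  qed
  have s: "?F \<inter> ?A (Suc n) m \<in> sets (quenched_law \<omega>)"
  proof (rule sets_prefix_event[of "Suc n + m"])
    fix X Y :: "nat \<Rightarrow> int ^ 'd" assume XY: "\<forall>i\<le>Suc n + m. X i = Y i"
    then show "X \<in> ?F \<inter> ?A (Suc n) m \<longleftrightarrow> Y \<in> ?F \<inter> ?A (Suc n) m"
      using F[of X Y] by simp
  qed
  have "emeasure (quenched_law \<omega>) (?F \<inter> ?A n (Suc m)) =
      (\<integral>\<^sup>+y. emeasure (quenched_law \<omega>) (?F \<inter> ?A (Suc n) m \<inter> {X. X (Suc n) = y}) \<partial>count_space (- {0}))"
    unfolding A by (subst emeasure_quenched_law_partition[OF s, symmetric]) (simp add: Int_assoc)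
  also have "\<dots> = (\<integral>\<^sup>+y. emeasure (quenched_law \<omega>) ?F *
       (ennreal (pmf (step_pmf \<omega> x) y) * avoid_prob \<omega> m y) \<partial>count_space (- {0}))"
  proof (rule nn_integral_cong)
    fix y
    have "?F \<inter> ?A (Suc n) m \<inter> {X. X (Suc n) = y} = ?F \<inter> {X. X (Suc n) = y} \<inter> ?A (Suc n) m" by auto
    then show "emeasure (quenched_law \<omega>) (?F \<inter> ?A (Suc n) m \<inter> {X. X (Suc n) = y}) =
        emeasure (quenched_law \<omega>) ?F * (ennreal (pmf (step_pmf \<omega> x) y) * avoid_prob \<omega> m y)"
      using Suc.IH[of "Suc n" ?F y, OF F] emeasure_quenched_law_Suc[of n E \<omega> x y, OF Suc.prems]
      by (simp only: mult.assoc)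
  qed
  also have "\<dots> = emeasure (quenched_law \<omega>) ?F * avoid_prob \<omega> (Suc m) x"
    by (simp add: nn_integral_cmult)
  finally show ?case .
qed

text \<open>Last-exit decomposition: the events that \<open>n\<close> is the time of the last visit to the origin
  are disjoint and have probability \<open>P(X\<^sub>n = 0)\<close> times the escape probability.\<close>

lemma recurrent_walk_if_not_summable:
  assumes "\<not> summable (\<lambda>n. measure (quenched_law \<omega>) {X. X n = 0})"
  shows "recurrent_walk \<omega>"
proof -
  interpret prob_space "quenched_law \<omega>" by (rule prob_space_quenched_law)
  define L where "L n m = {X :: nat \<Rightarrow> int ^ 'a. X n = 0} \<inter> {X. \<forall>k. n < k \<and> k \<le> n + m \<longrightarrow> X k \<noteq> 0}" for n m
  have sL: "L n m \<in> events" for n m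
    by (rule sets_prefix_event[of "n + m"]) (auto simp: L_def)
  have s0: "{X. X n = 0} \<in> events" for n
    by (rule sets_prefix_event[of n]) auto
  have eL: "emeasure (quenched_law \<omega>) (L n m) = emeasure (quenched_law \<omega>) {X. X n = 0} * avoid_prob \<omega> m 0" for n m
    using emeasure_quenched_law_avoid[of n UNIV \<omega> 0 m] by (simp add: L_def)
  have start: "emeasure (quenched_law \<omega>) {X. X 0 = 0} = 1"
    using emeasure_quenched_law_cylinder[of \<omega> 0 "\<lambda>_. 0"] by simp
  \<comment> \<open>The walk starts at the origin, so the case \<open>n = 0\<close> identifies
    \<open>avoid_prob \<omega> m 0\<close> with the probability of \<open>L 0 m\<close>.\<close>
  have L: "prob (L n m) = prob {X. X n = 0} * prob (L 0 m)" for n m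
    using eL[of n m] eL[of 0 m] start by (simp add: measure_def enn2real_mult)
  have dec: "decseq (L n)" for n
    by (auto simp: decseq_def L_def)
  define R where "R n = (\<Inter>m. L n m)" for n
  have sR: "R n \<in> events" for n unfolding R_def using sL by auto
  have R: "prob (R n) = prob {X. X n = 0} * prob (R 0)" for n
  proof (rule LIMSEQ_unique)
    show "(\<lambda>m. prob (L n m)) \<longlonglongrightarrow> prob (R n)"
      unfolding R_def by (rule finite_Lim_measure_decseq) (auto simp: sL dec)
    show "(\<lambda>m. prob (L n m)) \<longlonglongrightarrow> prob {X. X n = 0} * prob (R 0)"
      unfolding R_def L[of n] by (intro tendsto_mult finite_Lim_measure_decseq) (auto simp: sL dec)
  qed
  have R_iff: "X \<in> R n \<longleftrightarrow> X n = 0 \<and> (\<forall>k>n. X k \<noteq> 0)" for X n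
  proof
    assume X: "X \<in> R n"
    have "X k \<noteq> 0" if "k > n" for k
    proof -
      have "X \<in> L n (k - n)" using X by (auto simp: R_def)
      then show ?thesis using that by (simp add: L_def)
    qed
    then show "X n = 0 \<and> (\<forall>k>n. X k \<noteq> 0)" using X by (auto simp: R_def L_def)
  qed (auto simp: R_def L_def)
  have disj: "disjoint_family R"
    unfolding disjoint_family_on_def using R_iff by (metis disjoint_iff nat_neq_iff)
  have sums: "(\<lambda>n. prob (R n)) sums prob (\<Union>n. R n)"
    using sR disj by (intro finite_measure_UNION) auto
  \<comment> \<open>The disjoint events \<open>R n\<close> have summable probabilities. A positive
    escape probability could be divided out, making the return probabilities summable.\<close>
  have "prob (R 0) = 0"
  proof (rule ccontr)
    assume nz: "prob (R 0) \<noteq> 0"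
    have "summable (\<lambda>n. prob (R n) * inverse (prob (R 0)))"
      using sums_summable[OF sums] by (rule summable_mult2)
    moreover have "prob (R n) * inverse (prob (R 0)) = prob {X. X n = 0}" for n
      by (subst R) (simp add: nz)
    ultimately show False using assms by simp
  qed
  then have "prob (R n) = 0" for n using R[of n] by simp
  then have 0: "prob (\<Union>n. R n) = 0" using sums by (simp add: sums_iff)
  have "AE X in quenched_law \<omega>. X \<notin> (\<Union>n. R n)"
    using 0 sR by (subst AE_iff_measurable[where N="\<Union>n. R n"]) (auto simp: emeasure_eq_measure space_quenched_law)
  \<comment> \<open>Without a visit at time 0 the set of visit times could be empty and would have
    no maximum to serve as a last exit.\<close>
  moreover have "AE X in quenched_law \<omega>. X 0 = 0"
    using AE_prob_1[of "{X. X 0 = 0}"] start by (auto simp: measure_def)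
  ultimately have "AE X in quenched_law \<omega>. \<exists>\<^sub>\<infinity>n. X n = 0"
  proof eventually_elim
    case (elim X)
    show ?case
    proof (rule ccontr)
      assume "\<not> (\<exists>\<^sub>\<infinity>n. X n = 0)"
      then have fin: "finite {n. X n = 0}" by (simp add: INFM_iff_infinite)
      define n where "n = Max {n. X n = 0}"
      have "n \<in> {n. X n = 0}" unfolding n_def using fin elim(2) by (intro Max_in) auto
      moreover have "X k \<noteq> 0" if "k > n" for k
        using Max_ge[OF fin, of k] that by (auto simp: n_def[symmetric])
      ultimately have "X \<in> R n" unfolding R_iff by blast
      then show False using elim(1) by blast
    qed
  qed
  moreover have "{X \<in> space (quenched_law \<omega>). \<exists>\<^sub>\<infinity>n. X n = 0} \<in> events"
  proof -
    have "{X \<in> space (quenched_law \<omega>). \<exists>\<^sub>\<infinity>n. X n = 0} = (\<Inter>m. \<Union>n\<in>{m<..}. {X. X n = 0})"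
      by (auto simp: INFM_nat space_quenched_law)
    then show ?thesis using s0 by auto
  qed
  ultimately show ?thesis
    unfolding recurrent_walk_def by (simp add: prob_Collect_eq_1)
qed

section \<open>Symmetric walks on a set\<close>

text \<open>With \<open>infsum\<close>, symmetry, scaling and reindexing by a bijection hold without
  side conditions; only additivity asks for finite support.\<close>

definition dot :: "('a \<Rightarrow> real) \<Rightarrow> ('a \<Rightarrow> real) \<Rightarrow> real" where
  "dot f g = (\<Sum>\<^sub>\<infinity>x. f x * g x)"

abbreviation fin_supp :: "('a \<Rightarrow> real) \<Rightarrow> bool" where
  "fin_supp f \<equiv> finite {x. f x \<noteq> 0}"

lemma summable_on_fin_supp:
  fixes f :: "'a \<Rightarrow> real"
  assumes "fin_supp f"
  shows "f summable_on UNIV"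
  using assms summable_on_cong_neutral[of UNIV "{x. f x \<noteq> 0}" f f] by auto

lemma fin_supp_mult: "fin_supp f \<Longrightarrow> fin_supp (\<lambda>x. f x * g x)"
  by (rule finite_subset[of _ "{x. f x \<noteq> 0}"]) auto

lemma fin_supp_mult': "fin_supp g \<Longrightarrow> fin_supp (\<lambda>x. f x * g x)"
  by (rule finite_subset[of _ "{x. g x \<noteq> 0}"]) auto

lemma fin_supp_diff: "fin_supp f \<Longrightarrow> fin_supp g \<Longrightarrow> fin_supp (\<lambda>x. f x - g x)"
  by (rule finite_subset[of _ "{x. f x \<noteq> 0} \<union> {x. g x \<noteq> 0}"]) auto

lemma fin_supp_sum:
  assumes "finite I" "\<And>i. i \<in> I \<Longrightarrow> fin_supp (f i)"
  shows "fin_supp (\<lambda>x. \<Sum>i\<in>I. f i x)"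
proof (rule finite_subset)
  show "{x. (\<Sum>i\<in>I. f i x) \<noteq> 0} \<subseteq> (\<Union>i\<in>I. {x. f i x \<noteq> 0})"
  proof
    fix x assume "x \<in> {x. (\<Sum>i\<in>I. f i x) \<noteq> 0}"
    then have "(\<Sum>i\<in>I. f i x) \<noteq> 0" by simp
    then obtain i where "i \<in> I" "f i x \<noteq> 0" by (rule sum.not_neutral_contains_not_neutral)
    then show "x \<in> (\<Union>i\<in>I. {x. f i x \<noteq> 0})" by blast
  qed
qed (use assms in simp)

lemma fin_supp_comp_bij: "bij T \<Longrightarrow> fin_supp f \<Longrightarrow> fin_supp (\<lambda>x. f (T x))"
  using finite_vimageI[of "{x. f x \<noteq> 0}" T] by (simp add: bij_is_inj vimage_def)

lemma dot_commute: "dot f g = dot g f"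
  by (simp add: dot_def mult.commute)

lemma dot_diff_left:
  assumes "fin_supp f" "fin_supp g"
  shows "dot (\<lambda>x. f x - g x) h = dot f h - dot g h"
proof -
  have "dot (\<lambda>x. f x - g x) h = (\<Sum>\<^sub>\<infinity>x. f x * h x + - (g x * h x))"
    by (simp add: dot_def algebra_simps)
  also have "\<dots> = dot f h + (\<Sum>\<^sub>\<infinity>x. - (g x * h x))"
    unfolding dot_def using assms fin_supp_mult[of g h]
    by (intro infsum_add summable_on_fin_supp fin_supp_mult) auto
  finally show ?thesis by (simp add: dot_def infsum_uminus)
qed

lemma dot_cmult_left: "dot (\<lambda>x. c * f x) h = c * dot f h"
  by (simp add: dot_def mult.assoc infsum_cmult_right')

text \<open>Serves twice: \<open>t = 1\<close> expands squared increments, and general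
  \<open>t\<close> gives the quadratic polynomial of the variational argument.\<close>

lemma dot_diff_diff:
  assumes "fin_supp a" "fin_supp b" "fin_supp c" "fin_supp d"
  shows "dot (\<lambda>x. a x - t * b x) (\<lambda>x. c x - t * d x) =
    dot a c - t * dot a d - t * dot b c + t\<^sup>2 * dot b d"
proof -
  have l: "dot (\<lambda>x. a x - t * b x) h = dot a h - t * dot b h" if "fin_supp a" "fin_supp b" for a b h :: "'a \<Rightarrow> real"
    using that by (simp add: dot_diff_left dot_cmult_left fin_supp_mult')
  have r: "dot h (\<lambda>x. c x - t * d x) = dot h c - t * dot h d" for h
    unfolding dot_commute[of h] by (rule l[OF assms(3,4)])
  show ?thesis
    unfolding l[OF assms(1,2)] r by (simp add: algebra_simps power2_eq_square)
qed

lemma dot_sum_left: "finite I \<Longrightarrow> (\<And>i. i \<in> I \<Longrightarrow> fin_supp (f i)) \<Longrightarrow>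
    dot (\<lambda>x. \<Sum>i\<in>I. f i x) h = (\<Sum>i\<in>I. dot (f i) h)"
proof (induction I rule: finite_induct)
  case empty
  then show ?case by (simp add: dot_def)
next
  case (insert i I)
  have "dot (\<lambda>x. f i x + (\<Sum>i\<in>I. f i x)) h = dot (f i) h + dot (\<lambda>x. \<Sum>i\<in>I. f i x) h"
    unfolding dot_def distrib_right
    using insert by (intro infsum_add summable_on_fin_supp fin_supp_mult fin_supp_sum) auto
  then show ?case using insert by simp
qed

lemma dot_comp_bij: "bij T \<Longrightarrow> dot (\<lambda>x. f (T x)) (\<lambda>x. g (T x)) = dot f g"
  unfolding dot_def by (rule infsum_reindex_bij_betw)

lemma dot_finite: "finite F \<Longrightarrow> {x. f x \<noteq> 0} \<subseteq> F \<Longrightarrow> dot f g = (\<Sum>x\<in>F. f x * g x)"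
proof -
  assume F: "finite F" "{x. f x \<noteq> 0} \<subseteq> F"
  have "dot f g = (\<Sum>\<^sub>\<infinity>x\<in>F. f x * g x)"
    unfolding dot_def using F by (intro infsum_cong_neutral) auto
  then show ?thesis using F by simp
qed

text \<open>Walks that apply one of the maps \<open>T i\<close>, chosen uniformly. The involution
  \<open>r\<close> matches each map with its inverse, so counting measure is reversible. The site
  \<open>z\<close> is the starting point.\<close>

locale symmetric_walk =
  fixes I :: "'i set" and T :: "'i \<Rightarrow> 'a \<Rightarrow> 'a" and r :: "'i \<Rightarrow> 'i" and z :: 'a
  assumes fin_I: "finite I" and ne_I: "I \<noteq> {}"
    and r_in: "i \<in> I \<Longrightarrow> r i \<in> I" and r_r: "i \<in> I \<Longrightarrow> r (r i) = i"
    and T_r: "i \<in> I \<Longrightarrow> T (r i) (T i x) = x"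
begin

definition avg :: "('a \<Rightarrow> real) \<Rightarrow> 'a \<Rightarrow> real" where
  "avg f x = (\<Sum>i\<in>I. f (T i x)) / card I"

text \<open>Literally the probability of being at \<open>z\<close> after \<open>n\<close> steps from
  \<open>x\<close>; by reversibility also that of being at \<open>x\<close> after \<open>n\<close>
  steps from \<open>z\<close>.\<close>

primrec occ :: "nat \<Rightarrow> 'a \<Rightarrow> real" where
  "occ 0 = (\<lambda>x. if x = z then 1 else 0)"
| "occ (Suc n) = avg (occ n)"

text \<open>The Dirichlet form without normalisation: each undirected edge is counted from both
  ends, once through \<open>i\<close> and once through \<open>r i\<close>.\<close>

definition energy :: "('a \<Rightarrow> real) \<Rightarrow> real" where
  "energy f = (\<Sum>i\<in>I. dot (\<lambda>x. f x - f (T i x)) (\<lambda>x. f x - f (T i x)))"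

lemma card_pos: "card I > 0" using fin_I ne_I by (simp add: card_gt_0_iff)

lemma bij_T:
  assumes "i \<in> I"
  shows "bij (T i)"
proof (rule o_bij)
  show "T (r i) \<circ> T i = id" using T_r[OF assms] by (simp add: fun_eq_iff)
  show "T i \<circ> T (r i) = id" using T_r[OF r_in[OF assms]] r_r[OF assms] by (simp add: fun_eq_iff)
qed

lemma fin_supp_avg: "fin_supp f \<Longrightarrow> fin_supp (avg f)"
proof -
  assume f: "fin_supp f"
  have "avg f = (\<lambda>x. (\<Sum>i\<in>I. f (T i x)) * (1 / card I))" by (simp add: avg_def fun_eq_iff)
  then show ?thesis
    by (simp only:) (rule fin_supp_mult[OF fin_supp_sum[OF fin_I fin_supp_comp_bij[OF bij_T f]]])
qed

lemma fin_supp_occ: "fin_supp (occ n)"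
proof (induction n)
  case (Suc n)
  then show ?case unfolding occ.simps by (rule fin_supp_avg)
qed simp

lemma dot_avg_left:
  assumes "fin_supp f"
  shows "dot (avg f) g = (\<Sum>i\<in>I. dot (\<lambda>x. f (T i x)) g) / card I"
proof -
  have "avg f = (\<lambda>x. (1 / card I) * (\<Sum>i\<in>I. f (T i x)))" by (simp add: avg_def fun_eq_iff)
  then have "dot (avg f) g = 1 / card I * dot (\<lambda>x. \<Sum>i\<in>I. f (T i x)) g"
    by (simp only: dot_cmult_left)
  also have "dot (\<lambda>x. \<Sum>i\<in>I. f (T i x)) g = (\<Sum>i\<in>I. dot (\<lambda>x. f (T i x)) g)"
    by (rule dot_sum_left[OF fin_I fin_supp_comp_bij[OF bij_T assms]])
  finally show ?thesis by simp
qed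

lemma dot_comp_T:
  assumes "i \<in> I"
  shows "dot (\<lambda>x. f (T i x)) g = dot f (\<lambda>x. g (T (r i) x))"
proof -
  have "T i (T (r i) x) = x" for x
    using T_r[OF r_in[OF assms]] r_r[OF assms] by simp
  then show ?thesis
    using dot_comp_bij[OF bij_T[OF r_in[OF assms]], of "\<lambda>x. f (T i x)" g] by (simp only:)
qed

text \<open>The adjoint of composition with \<open>T i\<close> is composition with
  \<open>T (r i)\<close>, and \<open>r\<close> merely permutes the index set.\<close>

lemma avg_symmetric:
  assumes "fin_supp f" "fin_supp g"
  shows "dot (avg f) g = dot f (avg g)"
proof -
  have "(\<Sum>i\<in>I. dot (\<lambda>x. f (T i x)) g) = (\<Sum>i\<in>I. dot f (\<lambda>x. g (T (r i) x)))"
    by (simp add: dot_comp_T)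
  also have "\<dots> = (\<Sum>i\<in>I. dot f (\<lambda>x. g (T i x)))"
    by (rule sum.reindex_bij_witness[of _ r r]) (auto simp: r_in r_r)
  also have "\<dots> = (\<Sum>i\<in>I. dot (\<lambda>x. g (T i x)) f)"
    by (intro sum.cong refl dot_commute)
  finally show ?thesis
    unfolding dot_commute[of f "avg g"] dot_avg_left[OF assms(1)] dot_avg_left[OF assms(2)] by simp
qed

text \<open>Each \<open>T i\<close> preserves \<open>dot\<close>, so both squares in an increment
  contribute \<open>dot f f\<close> and only the mixed terms see the walk.\<close>

lemma energy_eq:
  assumes "fin_supp f"
  shows "energy f = 2 * card I * (dot f f - dot (avg f) f)"
proof -
  have "dot (\<lambda>x. f x - f (T i x)) (\<lambda>x. f x - f (T i x)) = 2 * dot f f - 2 * dot (\<lambda>x. f (T i x)) f" if "i \<in> I" for i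
  proof -
    have s: "fin_supp (\<lambda>x. f (T i x))" by (rule fin_supp_comp_bij[OF bij_T[OF that] assms])
    show ?thesis
      using dot_diff_diff[OF assms s assms s, of 1] dot_comp_bij[OF bij_T[OF that], of f f]
        dot_commute[of f "\<lambda>x. f (T i x)"] by simp
  qed
  then have "energy f = (\<Sum>i\<in>I. 2 * dot f f - 2 * dot (\<lambda>x. f (T i x)) f)" by (simp add: energy_def)
  also have "\<dots> = 2 * card I * dot f f - 2 * (\<Sum>i\<in>I. dot (\<lambda>x. f (T i x)) f)"
    by (simp add: sum_subtractf sum_distrib_left)
  finally show ?thesis
    unfolding dot_avg_left[OF assms] using card_pos by (simp add: right_diff_distrib)
qed

lemma energy_nonneg: "energy f \<ge> 0"
  unfolding energy_def dot_def by (intro sum_nonneg infsum_nonneg) auto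

text \<open>Self-adjointness lets the mixed term carry the Laplacian on \<open>g\<close> alone; for
  a truncated Green function that Laplacian is nearly a point mass.\<close>

lemma energy_diff:
  fixes t :: real
  assumes "fin_supp f" "fin_supp g"
  shows "energy (\<lambda>x. f x - t * g x) =
    energy f - 4 * card I * t * dot f (\<lambda>x. g x - avg g x) + t\<^sup>2 * energy g"
proof -
  have tg: "fin_supp (\<lambda>x. t * g x)" using assms by (intro fin_supp_mult')
  have avg_lin: "avg (\<lambda>x. f x - t * g x) = (\<lambda>x. avg f x - t * avg g x)"
    by (simp add: avg_def fun_eq_iff sum_subtractf sum_distrib_left diff_divide_distrib)
  have fa: "fin_supp (avg f)" and ga: "fin_supp (avg g)" using assms by (simp_all add: fin_supp_avg)
  have w: "dot f (\<lambda>x. g x - avg g x) = dot f g - dot (avg f) g"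
    unfolding dot_commute[of f] dot_diff_left[OF assms(2) ga] avg_symmetric[OF assms(2,1)]
    by (simp only: dot_commute[of g])
  have s: "dot (avg g) f = dot (avg f) g"
    unfolding avg_symmetric[OF assms(2,1)] by (rule dot_commute)
  have "energy (\<lambda>x. f x - t * g x) = 2 * card I * ((dot f f - t * dot f g - t * dot f g + t\<^sup>2 * dot g g) -
     (dot (avg f) f - t * dot (avg f) g - t * dot (avg f) g + t\<^sup>2 * dot (avg g) g))"
    unfolding energy_eq[OF fin_supp_diff[OF assms(1) tg]] avg_lin dot_diff_diff[OF assms assms] dot_diff_diff[OF fa ga assms] s
      dot_commute[of g f] ..
  then show ?thesis
    unfolding energy_eq[OF assms(1)] energy_eq[OF assms(2)] w by (simp add: algebra_simps)
qed

text \<open>Self-adjointness moves the steps one at a time to the second factor until the first is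
  the point mass at \<open>z\<close>.\<close>

lemma dot_occ: "dot (occ m) (occ n) = occ (m + n) z"
proof (induction m arbitrary: n)
  case 0
  have "dot (occ 0) (occ n) = (\<Sum>x\<in>{z}. occ 0 x * occ n x)" by (rule dot_finite) auto
  then show ?case by simp
next
  case (Suc m)
  have "dot (occ (Suc m)) (occ n) = dot (occ m) (occ (Suc n))"
    by (simp add: avg_symmetric fin_supp_occ)
  then show ?case using Suc[of "Suc n"] by simp
qed

lemma occ_nonneg: "occ n x \<ge> 0"
proof (induction n arbitrary: x)
  case (Suc n)
  then show ?case unfolding occ.simps avg_def by (intro divide_nonneg_nonneg sum_nonneg) simp_all
qed simp

text \<open>The left side is a single term of \<open>dot (occ n) (occ n)\<close>. Summable returns
  to \<open>z\<close> thus force \<open>occ n x\<close> to zero at every \<open>x\<close>.\<close>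

lemma occ_square_le: "(occ n x)\<^sup>2 \<le> occ (n + n) z"
proof -
  have "(occ n x)\<^sup>2 = (\<Sum>x\<in>{x}. occ n x * occ n x)" by (simp add: power2_eq_square)
  also have "\<dots> \<le> (\<Sum>x\<in>insert x {x. occ n x \<noteq> 0}. occ n x * occ n x)"
    using fin_supp_occ by (intro sum_mono2) auto
  also have "\<dots> = dot (occ n) (occ n)"
    using fin_supp_occ by (intro dot_finite[symmetric]) auto
  finally show ?thesis by (simp add: dot_occ)
qed

text \<open>If the Green function at \<open>z\<close> were finite, with value at most \<open>S\<close>, then testing the
  nonnegativity of the energy on \<open>f - t G\<close>, where \<open>G\<close> is the truncated Green function, would
  bound the energy of every \<open>f\<close> with \<open>f z = 1\<close> from below.\<close>

lemma not_summable_occ: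
  assumes test: "\<And>\<epsilon>. \<epsilon> > 0 \<Longrightarrow> \<exists>f. fin_supp f \<and> f z = 1 \<and> energy f < \<epsilon>"
  shows "\<not> summable (\<lambda>n. occ n z)"
proof
  assume sm: "summable (\<lambda>n. occ n z)"
  define S where "S = (\<Sum>n. occ n z)"
  have S_ge: "(\<Sum>n<N. occ n z) \<le> S" for N
    unfolding S_def by (rule sum_le_suminf[OF sm]) (auto simp: occ_nonneg)
  have S1: "S \<ge> 1" using S_ge[of 1] by simp
  define c where "c = real (card I)"
  have c: "c > 0" using card_pos by (simp add: c_def)
  obtain f where f: "fin_supp f" "f z = 1" "energy f < c / S"
    using test[of "c / S"] c S1 by auto
  have "(\<lambda>n. occ (2 * n) z) \<longlonglongrightarrow> 0"
    using LIMSEQ_subseq_LIMSEQ[OF summable_LIMSEQ_zero[OF sm], of "\<lambda>n. 2 * n"]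
    by (simp add: strict_mono_def o_def)
  then have occ0: "(\<lambda>n. occ n x) \<longlonglongrightarrow> 0" for x
  proof -
    assume "(\<lambda>n. occ (2 * n) z) \<longlonglongrightarrow> 0"
    then have "(\<lambda>n. sqrt (occ (2 * n) z)) \<longlonglongrightarrow> 0"
      using tendsto_real_sqrt by force
    then show ?thesis
    proof (rule tendsto_0_le[where K = 1], intro always_eventually allI)
      fix n
      have "occ n x \<le> sqrt (occ (2 * n) z)"
        using occ_square_le[of n x] by (simp add: real_le_rsqrt mult_2)
      then show "norm (occ n x) \<le> norm (sqrt (occ (2 * n) z)) * 1"
        using occ_nonneg[of n x] by simp
    qed
  qed
  have "(\<lambda>n. dot f (occ n)) \<longlonglongrightarrow> 0"
  proof -
    have "dot f (occ n) = (\<Sum>x\<in>{x. f x \<noteq> 0}. f x * occ n x)" for n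
      using f by (intro dot_finite) auto
    moreover have "(\<lambda>n. \<Sum>x\<in>{x. f x \<noteq> 0}. f x * occ n x) \<longlonglongrightarrow> (\<Sum>x\<in>{x. f x \<noteq> 0}. f x * 0)"
      by (intro tendsto_intros occ0)
    ultimately show ?thesis by simp
  qed
  \<comment> \<open>The tolerance \<open>1 / 4\<close> is the loss of the final estimate: it leaves
    \<open>3 / 4\<close> of the value \<open>f z = 1\<close>.\<close>
  then have "eventually (\<lambda>n. dot f (occ n) < 1 / 4) sequentially"
    by (rule order_tendstoD) simp
  then obtain N where N: "dot f (occ N) < 1 / 4" by (auto simp: eventually_sequentially)
  \<comment> \<open>Truncation keeps the support finite, and the telescoping Laplacian then has
    \<open>occ N\<close> as its only error term.\<close>
  define G where "G x = (\<Sum>n<N. occ n x)" for x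
  have G: "fin_supp G" unfolding G_def by (intro fin_supp_sum fin_supp_occ) auto
  have GG: "(\<lambda>x. G x - avg G x) = (\<lambda>x. occ 0 x - occ N x)"
  proof
    fix x
    have "avg G x = (\<Sum>n<N. occ (Suc n) x)"
      unfolding avg_def G_def by (subst sum.swap) (simp add: sum_divide_distrib avg_def)
    then have "G x - avg G x = (\<Sum>n<N. occ n x - occ (Suc n) x)"
      by (simp only: G_def sum_subtractf)
    also have "\<dots> = occ 0 x - occ N x" by (rule sum_lessThan_telescope')
    finally show "G x - avg G x = occ 0 x - occ N x" .
  qed
  have dot_z: "dot (occ 0) h = h z" for h
    by (subst dot_finite[of "{z}"]) auto
  have "dot f (\<lambda>x. G x - avg G x) = f z - dot f (occ N)"
    unfolding GG dot_commute[of f] dot_diff_left[OF fin_supp_occ fin_supp_occ] dot_z ..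
  then have fG: "dot f (\<lambda>x. G x - avg G x) > 3 / 4" using f N by simp
  have "energy G = 2 * c * dot (\<lambda>x. G x - avg G x) G"
    using G by (simp add: energy_eq c_def dot_diff_left fin_supp_avg)
  also have "dot (\<lambda>x. G x - avg G x) G = G z - dot (occ N) G"
    unfolding GG dot_diff_left[OF fin_supp_occ fin_supp_occ] dot_z ..
  also have "dot (occ N) G \<ge> 0"
    unfolding dot_def G_def by (intro infsum_nonneg mult_nonneg_nonneg sum_nonneg occ_nonneg)
  then have "2 * c * (G z - dot (occ N) G) \<le> 2 * c * S"
    using S_ge[of N] c by (simp add: G_def)
  finally have EG: "energy G \<le> 2 * c * S" .
  \<comment> \<open>The choice \<open>t = 1 / S\<close> minimises
    \<open>2 * c * S * t^2 - 4 * c * t\<close>, the polynomial without truncation error. With that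
    error the terms are \<open>- 3 * c / S\<close> and \<open>2 * c / S\<close>, hence the threshold
    \<open>c / S\<close> for the energy of \<open>f\<close>.\<close>
  have "0 \<le> energy f - 4 * c * (1 / S) * dot f (\<lambda>x. G x - avg G x) + (1 / S)\<^sup>2 * energy G"
    using energy_nonneg[of "\<lambda>x. f x - (1 / S) * G x"] energy_diff[OF f(1) G, of "1 / S"] by (simp add: c_def)
  moreover have "(1 / S)\<^sup>2 * energy G \<le> (1 / S)\<^sup>2 * (2 * c * S)"
    using EG by (intro mult_left_mono) auto
  moreover have "(1 / S)\<^sup>2 * (2 * c * S) = 2 * (c / S)" using S1 by (simp add: power2_eq_square)
  moreover have "4 * c * (1 / S) * dot f (\<lambda>x. G x - avg G x) \<ge> 4 * c * (1 / S) * (3 / 4)"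
    using fG c S1 by (intro mult_left_mono) auto
  ultimately show False using f(3) by simp
qed

end

section \<open>The graph of coordinate nearest neighbours\<close>

text \<open>Strict lower bounds avoid speaking of a minimum, so the value \<infinity> of a direction
  without points is covered too.\<close>

lemma first_point_gt_iff:
  "enat n < first_point e \<omega> \<longleftrightarrow> (\<forall>k. 0 < k \<and> k \<le> n \<longrightarrow> \<not> \<omega> (int k *s e))"
proof -
  have "enat n < first_point e \<omega> \<longleftrightarrow> (\<forall>k\<in>{k. 0 < k \<and> \<omega> (int k *s e)}. enat (Suc n) \<le> enat k)"
    unfolding first_point_def Suc_ile_eq[symmetric] by (rule le_INF_iff)
  also have "\<dots> \<longleftrightarrow> (\<forall>k. 0 < k \<and> k \<le> n \<longrightarrow> \<not> \<omega> (int k *s e))"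
    unfolding enat_ord_simps Suc_le_eq by (auto simp: not_less)
  finally show ?thesis .
qed

lemma first_point_eq_iff:
  "first_point e \<omega> = enat k \<longleftrightarrow> 0 < k \<and> \<omega> (int k *s e) \<and> (\<forall>j. 0 < j \<and> j < k \<longrightarrow> \<not> \<omega> (int j *s e))"
proof (cases k)
  case 0
  have "enat 0 < first_point e \<omega>" by (simp add: first_point_gt_iff)
  then show ?thesis using 0 by auto
next
  case (Suc m)
  have "first_point e \<omega> = enat k \<longleftrightarrow> enat m < first_point e \<omega> \<and> \<not> enat k < first_point e \<omega>"
    unfolding Suc Suc_ile_eq[symmetric] not_less by (cases "first_point e \<omega>") auto
  also have "\<dots> \<longleftrightarrow> 0 < k \<and> \<omega> (int k *s e) \<and> (\<forall>j. 0 < j \<and> j < k \<longrightarrow> \<not> \<omega> (int j *s e))"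
    unfolding first_point_gt_iff Suc by (auto simp: le_Suc_eq less_Suc_eq_le)
  finally show ?thesis .
qed

text \<open>An edge is a pair of points with no point strictly between them, a condition that does
  not distinguish its ends.\<close>

lemma first_point_reverse:
  assumes "\<omega> v" "first_point e (shift v \<omega>) = enat k"
  shows "\<omega> (v + int k *s e)" "first_point (- e) (shift (v + int k *s e) \<omega>) = enat k"
proof -
  have k: "0 < k" "\<omega> (v + int k *s e)" "\<And>j. 0 < j \<Longrightarrow> j < k \<Longrightarrow> \<not> \<omega> (v + int j *s e)"
    using assms(2) by (auto simp: first_point_eq_iff shift_def)
  have *: "v + int k *s e + int j *s - e = v + int (k - j) *s e" if "j \<le> k" for j
    using that by (simp add: of_nat_diff vec_eq_iff algebra_simps)
  have "\<not> \<omega> (v + int k *s e + int j *s - e)" if "0 < j" "j < k" for j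
    unfolding *[OF less_imp_le[OF that(2)]] using k(3)[of "k - j"] that by simp
  moreover have "\<omega> (v + int k *s e + int k *s - e)"
    unfolding *[OF le_refl] using assms(1) by (simp add: vec_eq_iff)
  ultimately show "first_point (- e) (shift (v + int k *s e) \<omega>) = enat k"
    unfolding first_point_eq_iff shift_def using k(1) by blast
  show "\<omega> (v + int k *s e)" by (rule k(2))
qed

lemma first_point_reverse_iff:
  "\<omega> v \<and> first_point e (shift v \<omega>) = enat k \<longleftrightarrow>
   \<omega> (v + int k *s e) \<and> first_point (- e) (shift (v + int k *s e) \<omega>) = enat k"
proof -
  have "v + int k *s e + int k *s - e = v" by (simp add: vec_eq_iff)
  then show ?thesis
    using first_point_reverse[of \<omega> v e k] first_point_reverse[of \<omega> "v + int k *s e" "- e" k]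
    by (metis minus_minus)
qed

text \<open>Together with a point at the origin, this is all that the quenched argument asks of
  \<omega>; the rest of that argument is deterministic.\<close>

definition no_dead_end :: "('d::finite) config \<Rightarrow> bool" where
  "no_dead_end \<omega> \<longleftrightarrow> (\<forall>v. \<omega> v \<longrightarrow> (\<forall>e\<in>unit_steps. first_point e (shift v \<omega>) \<noteq> \<infinity>))"

text \<open>Standing still outside the process makes each \<open>jump \<omega> e\<close> a
  permutation of the lattice, with inverse \<open>jump \<omega> (- e)\<close>, and adds nothing to
  the energy.\<close>

definition jump :: "('d::finite) config \<Rightarrow> int ^ 'd \<Rightarrow> int ^ 'd \<Rightarrow> int ^ 'd" where
  "jump \<omega> e v = (if \<omega> v then v + int (the_enat (first_point e (shift v \<omega>))) *s e else v)"

lemma unit_steps_minus: "e \<in> unit_steps \<Longrightarrow> - e \<in> unit_steps"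
  unfolding unit_steps_def by fastforce

lemma finite_unit_steps: "finite (unit_steps :: (int ^ 'd::finite) set)"
  by (simp add: unit_steps_def)

lemma jump_in:
  assumes "no_dead_end \<omega>" "\<omega> v" "e \<in> unit_steps"
  obtains k where "first_point e (shift v \<omega>) = enat k" "jump \<omega> e v = v + int k *s e"
  using assms by (auto simp: no_dead_end_def jump_def)

lemma symmetric_walk_jump:
  fixes \<omega> :: "('d::finite) config"
  assumes "no_dead_end \<omega>"
  shows "symmetric_walk unit_steps (jump \<omega>) uminus"
proof
  show "finite (unit_steps :: (int ^ 'd) set)" "unit_steps \<noteq> ({} :: (int ^ 'd) set)"
    by (auto simp: unit_steps_def)
  fix e :: "int ^ 'd" and x assume e: "e \<in> unit_steps"
  show "- e \<in> unit_steps" "- (- e) = e" using e by (simp_all add: unit_steps_minus)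
  show "jump \<omega> (- e) (jump \<omega> e x) = x"
  proof (cases "\<omega> x")
    case True
    obtain k where k: "first_point e (shift x \<omega>) = enat k" "jump \<omega> e x = x + int k *s e"
      using jump_in[OF assms True e] .
    have "x + int k *s e + int k *s - e = x" by (simp add: vec_eq_iff)
    then show ?thesis
      unfolding k(2) jump_def[of \<omega> "- e"] using first_point_reverse[OF True k(1)] by (simp only: if_True the_enat.simps)
  qed (simp add: jump_def)
qed

lemma pmf_step_pmf_jump:
  fixes \<omega> :: "('d::finite) config"
  assumes "no_dead_end \<omega>" "\<omega> v"
  shows "pmf (step_pmf \<omega> v) u = (\<Sum>e\<in>unit_steps. of_bool (jump \<omega> e v = u)) / card (unit_steps :: (int ^ 'd) set)"
proof -
  have fin: "first_point e (shift v \<omega>) \<noteq> \<infinity>" if "e \<in> unit_steps" for e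
    using assms that by (auto simp: no_dead_end_def)
  have nb: "neighbours \<omega> v = (\<lambda>e. jump \<omega> e v) ` unit_steps"
  proof -
    have "u = v + int k *s e \<longleftrightarrow> u = jump \<omega> e v" if "first_point e (shift v \<omega>) = enat k" for u e k
      using that assms by (simp add: jump_def)
    moreover have "\<exists>k. first_point e (shift v \<omega>) = enat k" if "e \<in> unit_steps" for e
      using fin[OF that] by auto
    ultimately show ?thesis unfolding neighbours_def by blast
  qed
  \<comment> \<open>Injectivity comes by counting: the image is the neighbour set, which has as many
    elements as there are directions.\<close>
  have inj: "inj_on (\<lambda>e. jump \<omega> e v) unit_steps"
    by (rule eq_card_imp_inj_on)
       (simp_all add: finite_unit_steps nb[symmetric] card_neighbours[OF fin] card_unit_steps)
  have "(\<Sum>e\<in>unit_steps. of_bool (jump \<omega> e v = u)) = real (card {e\<in>unit_steps. jump \<omega> e v = u})"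
    by (simp add: finite_unit_steps Int_def)
  also have "card {e\<in>unit_steps. jump \<omega> e v = u} = of_bool (u \<in> neighbours \<omega> v)"
  proof (cases "u \<in> neighbours \<omega> v")
    case True
    then obtain e where e: "e \<in> unit_steps" "u = jump \<omega> e v" using nb by auto
    have "{e'\<in>unit_steps. jump \<omega> e' v = u} = {e}"
      using e inj by (auto simp: inj_on_def)
    then show ?thesis using True by simp
  next
    case False
    then have "{e\<in>unit_steps. jump \<omega> e v = u} = {}" using nb by auto
    then show ?thesis using False by (simp only: card.empty of_bool_eq)
  qed
  finally have "(\<Sum>e\<in>unit_steps. of_bool (jump \<omega> e v = u)) = (of_bool (u \<in> neighbours \<omega> v) :: real)"
    by simp
  moreover have "pmf (step_pmf \<omega> v) u = transition_prob \<omega> v u"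
    by (rule pmf_step_pmf) (rule fin)
  ultimately show ?thesis
    by (simp add: transition_prob_def card_unit_steps)
qed

section \<open>The quenched walk as a symmetric walk\<close>

context
  fixes \<omega> :: "('d::finite) config"
  assumes nde: "no_dead_end \<omega>" and origin: "\<omega> 0"
begin

interpretation symmetric_walk unit_steps "jump \<omega>" uminus "0 :: int ^ 'd"
  by (rule symmetric_walk_jump[OF nde])

text \<open>A site outside the process only jumps to itself, so it never receives mass from the
  process.\<close>

lemma occ_support: "occ n x \<noteq> 0 \<Longrightarrow> \<omega> x"
proof (induction n arbitrary: x)
  case 0
  then show ?case using origin by (simp split: if_splits)
next
  case (Suc n)
  then have "(\<Sum>e\<in>unit_steps. occ n (jump \<omega> e x)) \<noteq> 0" by (auto simp: avg_def)
  then obtain e where "e \<in> unit_steps" "occ n (jump \<omega> e x) \<noteq> 0" by (rule sum.not_neutral_contains_not_neutral)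
  then have "\<omega> (jump \<omega> e x)" by (intro Suc.IH)
  then show ?case by (cases "\<omega> x") (simp_all add: jump_def)
qed

lemma emeasure_quenched_law_occ: "emeasure (quenched_law \<omega>) {X. X n = x} = ennreal (occ n x)"
proof (induction n arbitrary: x)
  case 0
  show ?case
    using emeasure_quenched_law_cylinder[of \<omega> 0 "\<lambda>_. x"] by simp
next
  case (Suc n)
  let ?c = "real (card (unit_steps :: (int ^ 'd) set))"
  have c: "?c > 0" using card_pos by simp
  have s: "{X. X (Suc n) = x} \<in> sets (quenched_law \<omega>)"
    by (rule sets_prefix_event[of "Suc n"]) auto
  \<comment> \<open>The predecessors of \<open>x\<close> are its own neighbours, found by inverting
    the permutations.\<close>
  have jump_eq: "jump \<omega> e y = x \<longleftrightarrow> y = jump \<omega> (- e) x" if "e \<in> unit_steps" for e y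
    using T_r[OF that] T_r[OF unit_steps_minus[OF that]] by auto
  have "emeasure (quenched_law \<omega>) {X. X (Suc n) = x} =
      (\<integral>\<^sup>+y. emeasure (quenched_law \<omega>) ({X. X (Suc n) = x} \<inter> {X. X n = y}) \<partial>count_space UNIV)"
    using emeasure_quenched_law_partition[OF s, of n UNIV] by simp
  also have "\<dots> = (\<integral>\<^sup>+y. ennreal (occ n y) * ennreal (pmf (step_pmf \<omega> y) x) \<partial>count_space UNIV)"
  proof (rule nn_integral_cong)
    fix y
    have "emeasure (quenched_law \<omega>) (UNIV \<inter> {X. X n = y} \<inter> {X. X (Suc n) = x}) =
      emeasure (quenched_law \<omega>) (UNIV \<inter> {X. X n = y}) * ennreal (pmf (step_pmf \<omega> y) x)"
      by (rule emeasure_quenched_law_Suc) simp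
    then show "emeasure (quenched_law \<omega>) ({X. X (Suc n) = x} \<inter> {X. X n = y}) =
      ennreal (occ n y) * ennreal (pmf (step_pmf \<omega> y) x)"
      by (simp add: Suc Int_commute)
  qed
  also have "\<dots> = (\<integral>\<^sup>+y. (\<Sum>e\<in>unit_steps. ennreal (occ n (jump \<omega> (- e) x) / ?c) * indicator {jump \<omega> (- e) x} y) \<partial>count_space UNIV)"
  proof (rule nn_integral_cong)
    fix y
    have "occ n y * pmf (step_pmf \<omega> y) x = (\<Sum>e\<in>unit_steps. occ n (jump \<omega> (- e) x) / ?c * indicator {jump \<omega> (- e) x} y)"
    proof (cases "\<omega> y")
      case True
      have "occ n y * pmf (step_pmf \<omega> y) x = (\<Sum>e\<in>unit_steps. occ n y / ?c * of_bool (jump \<omega> e y = x))"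
        unfolding pmf_step_pmf_jump[OF nde True] by (simp add: sum_distrib_left sum_divide_distrib)
      also have "\<dots> = (\<Sum>e\<in>unit_steps. occ n (jump \<omega> (- e) x) / ?c * indicator {jump \<omega> (- e) x} y)"
      proof (rule sum.cong)
        fix e :: "int ^ 'd" assume e: "e \<in> unit_steps"
        show "occ n y / ?c * of_bool (jump \<omega> e y = x) =
            occ n (jump \<omega> (- e) x) / ?c * indicator {jump \<omega> (- e) x} y"
          unfolding jump_eq[OF e] by (cases "y = jump \<omega> (- e) x") simp_all
      qed simp
      finally show ?thesis .
    next
      case False
      \<comment> \<open>Outside the process \<open>step_pmf\<close> is not controlled, but such
        sites carry no mass.\<close>
      then have y: "occ n y = 0" using occ_support by blast
      then have "occ n (jump \<omega> (- e) x) / ?c * indicator {jump \<omega> (- e) x} y = 0" for e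
        by (cases "y = jump \<omega> (- e) x") simp_all
      then show ?thesis using y by (simp only: mult_zero_left sum.neutral_const)
    qed
    then have "ennreal (occ n y * pmf (step_pmf \<omega> y) x) = ennreal (\<Sum>e\<in>unit_steps. occ n (jump \<omega> (- e) x) / ?c * indicator {jump \<omega> (- e) x} y)"
      by (simp only:)
    also have "\<dots> = (\<Sum>e\<in>unit_steps. ennreal (occ n (jump \<omega> (- e) x) / ?c * indicator {jump \<omega> (- e) x} y))"
      using occ_nonneg c by (intro sum_ennreal[symmetric]) auto
    finally have fin: "ennreal (occ n y * pmf (step_pmf \<omega> y) x) = (\<Sum>e\<in>unit_steps. ennreal (occ n (jump \<omega> (- e) x) / ?c * indicator {jump \<omega> (- e) x} y))" .
    show "ennreal (occ n y) * ennreal (pmf (step_pmf \<omega> y) x) =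
      (\<Sum>e\<in>unit_steps. ennreal (occ n (jump \<omega> (- e) x) / ?c) * indicator {jump \<omega> (- e) x} y)"
    proof -
      have "ennreal (a * indicator A y) = ennreal a * indicator A y" for a :: real and A
        by (simp add: indicator_def)
      then show ?thesis
        using fin occ_nonneg[of n y]
        by (simp only: ennreal_mult pmf_nonneg)
    qed
  qed
  also have "\<dots> = (\<Sum>e\<in>unit_steps. ennreal (occ n (jump \<omega> (- e) x) / ?c))"
  proof (subst nn_integral_sum)
    have "(\<integral>\<^sup>+y. a * indicator {z} y \<partial>count_space UNIV) = a" for a :: ennreal and z :: "int ^ 'd"
      by (subst nn_integral_cmult_indicator) auto
    then show "(\<Sum>e\<in>unit_steps. \<integral>\<^sup>+y. ennreal (occ n (jump \<omega> (- e) x) / ?c) * indicator {jump \<omega> (- e) x} y \<partial>count_space UNIV) =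
        (\<Sum>e\<in>unit_steps. ennreal (occ n (jump \<omega> (- e) x) / ?c))"
      by (simp only:)
  qed simp
  \<comment> \<open>Reversing directions turns the sum over predecessors into the average over
    successors that defines \<open>occ\<close>.\<close>
  also have "\<dots> = (\<Sum>e\<in>unit_steps. ennreal (occ n (jump \<omega> e x) / ?c))"
    by (rule sum.reindex_bij_witness[of _ uminus uminus]) (auto simp: unit_steps_minus)
  also have "\<dots> = ennreal (occ (Suc n) x)"
    unfolding occ.simps avg_def sum_divide_distrib using occ_nonneg c by (intro sum_ennreal) auto
  finally show ?case .
qed

lemma recurrent_walk_if_small_energy:
  assumes "\<And>\<epsilon>. \<epsilon> > 0 \<Longrightarrow> \<exists>f. fin_supp f \<and> f 0 = 1 \<and>
    (\<Sum>e\<in>unit_steps. \<integral>\<^sup>+x. ennreal ((f x - f (jump \<omega> e x))\<^sup>2) \<partial>count_space UNIV) < ennreal \<epsilon>"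
  shows "recurrent_walk \<omega>"
proof (rule recurrent_walk_if_not_summable)
  have "\<exists>f. fin_supp f \<and> f 0 = 1 \<and> energy f < \<epsilon>" if \<epsilon>: "\<epsilon> > 0" for \<epsilon>
  proof -
    obtain f where f: "fin_supp f" "f 0 = 1"
      "(\<Sum>e\<in>unit_steps. \<integral>\<^sup>+x. ennreal ((f x - f (jump \<omega> e x))\<^sup>2) \<partial>count_space UNIV) < ennreal \<epsilon>"
      using assms[OF \<epsilon>] by blast
    have "(\<integral>\<^sup>+x. ennreal ((f x - f (jump \<omega> e x))\<^sup>2) \<partial>count_space UNIV) =
       ennreal (dot (\<lambda>x. f x - f (jump \<omega> e x)) (\<lambda>x. f x - f (jump \<omega> e x)))" if "e \<in> unit_steps" for e
    proof -
      let ?g = "\<lambda>x. f x - f (jump \<omega> e x)"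
      have g: "fin_supp ?g" by (rule fin_supp_diff[OF f(1) fin_supp_comp_bij[OF bij_T[OF that] f(1)]])
      have "(\<integral>\<^sup>+x. ennreal ((?g x)\<^sup>2) \<partial>count_space UNIV) = (\<Sum>x\<in>{x. ?g x \<noteq> 0}. ennreal ((?g x)\<^sup>2))"
        by (rule nn_integral_count_space') (use g in auto)
      also have "\<dots> = ennreal (\<Sum>x\<in>{x. ?g x \<noteq> 0}. ?g x * ?g x)"
        by (subst sum_ennreal) (auto simp: power2_eq_square)
      also have "(\<Sum>x\<in>{x. ?g x \<noteq> 0}. ?g x * ?g x) = dot ?g ?g"
        by (rule dot_finite[symmetric]) (use g in auto)
      finally show ?thesis .
    qed
    then have "(\<Sum>e\<in>unit_steps. \<integral>\<^sup>+x. ennreal ((f x - f (jump \<omega> e x))\<^sup>2) \<partial>count_space UNIV) =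
        (\<Sum>e\<in>unit_steps. ennreal (dot (\<lambda>x. f x - f (jump \<omega> e x)) (\<lambda>x. f x - f (jump \<omega> e x))))"
      by (rule sum.cong[OF refl])
    also have "\<dots> = ennreal (energy f)"
      unfolding energy_def by (rule sum_ennreal) (auto simp: dot_def intro!: infsum_nonneg)
    finally have "energy f < \<epsilon>" using f(3) \<epsilon> by (simp add: ennreal_less_iff energy_nonneg)
    then show ?thesis using f by blast
  qed
  then have "\<not> summable (\<lambda>n. occ n 0)" by (rule not_summable_occ)
  moreover have "measure (quenched_law \<omega>) {X. X n = 0} = occ n 0" for n
    by (simp add: measure_def emeasure_quenched_law_occ occ_nonneg)
  ultimately show "\<not> summable (\<lambda>n. measure (quenched_law \<omega>) {X. X n = 0})" by simp
qed

end

section \<open>Stationarity and gap lengths\<close>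

lemma ennreal_mult_le_1D:
  fixes a b :: ennreal
  assumes "a * b \<le> 1"
  shows "a \<le> inverse b"
proof (cases "b = 0 \<or> b = \<infinity>")
  case True
  then show ?thesis using assms by (cases "a = 0") (auto simp: ennreal_mult_top top_unique)
next
  case False
  then have "a = a * b / b" by (simp add: mult_divide_eq_ennreal)
  also have "\<dots> \<le> 1 / b" using assms by (rule divide_right_mono_ennreal)
  finally show ?thesis by (simp add: divide_ennreal_def)
qed

lemma inverse_ennreal_le_1:
  fixes b :: ennreal
  assumes "1 \<le> b"
  shows "inverse b \<le> 1"
proof (cases b)
  case (real r)
  then have "1 \<le> r" using assms by (simp add: ennreal_1[symmetric] del: ennreal_1)
  then have "ennreal (inverse r) \<le> ennreal 1" by (intro ennreal_leI) (simp add: inverse_le_1_iff)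
  then show ?thesis using \<open>1 \<le> r\<close> real by (simp add: inverse_ennreal)
qed simp

lemma shift_shift: "shift a (shift b \<omega>) = shift (a + b) \<omega>"
  by (simp add: shift_def add_ac)

text \<open>The density per site of edges of length \<open>k\<close> in direction \<open>e\<close>.
  It is taken under \<open>Q\<close> and not \<open>palm Q\<close> because the energy sums over all
  sites and \<open>Q\<close> is the shift-invariant measure.\<close>

definition gap_prob :: "('d::finite) config measure \<Rightarrow> int ^ 'd \<Rightarrow> nat \<Rightarrow> ennreal" where
  "gap_prob Q e k = emeasure Q {\<omega>. \<omega> 0 \<and> first_point e \<omega> = enat k}"

text \<open>Splitting by gap length puts all randomness into indicators, with deterministic
  increments as coefficients.\<close>

definition random_energy :: "int ^ 'd \<Rightarrow> (int ^ 'd \<Rightarrow> real) \<Rightarrow> ('d::finite) config \<Rightarrow> ennreal" where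
  "random_energy e f \<omega> = (\<integral>\<^sup>+x. \<integral>\<^sup>+k. indicator {\<omega>. \<omega> x \<and> first_point e (shift x \<omega>) = enat k} \<omega> *
     ennreal ((f x - f (x + int k *s e))\<^sup>2) \<partial>count_space UNIV \<partial>count_space UNIV)"

lemma jump_energy_eq_random_energy:
  assumes "no_dead_end \<omega>" "e \<in> unit_steps"
  shows "(\<integral>\<^sup>+x. ennreal ((f x - f (jump \<omega> e x))\<^sup>2) \<partial>count_space UNIV) = random_energy e f \<omega>"
  unfolding random_energy_def
proof (rule nn_integral_cong)
  fix x
  let ?g = "\<lambda>k. ennreal ((f x - f (x + int k *s e))\<^sup>2)"
  show "ennreal ((f x - f (jump \<omega> e x))\<^sup>2) =
      (\<integral>\<^sup>+k. indicator {\<omega>. \<omega> x \<and> first_point e (shift x \<omega>) = enat k} \<omega> * ?g k \<partial>count_space UNIV)"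
  proof (cases "\<omega> x")
    case True
    obtain m where m: "first_point e (shift x \<omega>) = enat m" "jump \<omega> e x = x + int m *s e"
      using jump_in[OF assms(1) True assms(2)] .
    have "(\<integral>\<^sup>+k. indicator {\<omega>. \<omega> x \<and> first_point e (shift x \<omega>) = enat k} \<omega> * ?g k \<partial>count_space UNIV)
        = (\<integral>\<^sup>+k. ?g m * indicator {m} k \<partial>count_space UNIV)"
      by (rule nn_integral_cong) (auto simp: m True indicator_def)
    also have "\<dots> = ?g m" by (subst nn_integral_cmult_indicator) auto
    finally show ?thesis by (simp add: m(2))
  qed (simp add: jump_def)
qed

context ergodic_point_process
begin

lemma space_Q: "space Q = UNIV"
  using sets_eq_imp_space_eq[OF sets_Q] by (simp add: config_space_def space_PiM)

lemma measurable_config [measurable]: "(\<lambda>\<omega>. \<omega> x) \<in> measurable Q (count_space UNIV)"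
proof -
  have "(\<lambda>\<omega>. \<omega> x) \<in> measurable config_space (count_space UNIV)"
    unfolding config_space_def by simp
  then show ?thesis by (simp add: measurable_cong_sets[OF sets_Q refl])
qed

lemma measurable_shift [measurable]: "shift x \<in> measurable Q Q"
proof -
  have "shift x \<in> measurable Q (\<Pi>\<^sub>M x\<in>UNIV. count_space UNIV)"
    by (rule measurable_PiM_single') (auto simp: shift_def)
  then show ?thesis
    using measurable_cong_sets[OF refl sets_Q, of Q] by (simp add: config_space_def)
qed

text \<open>The vectors whose shift preserves \<open>Q\<close> form a subgroup of the lattice
  containing the standard basis.\<close>

lemma distr_shift: "distr Q Q (shift x) = Q"
proof -
  define G where "G = {x. distr Q Q (shift x) = Q}"
  have add: "x + y \<in> G" if "x \<in> G" "y \<in> G" for x y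
  proof -
    have "distr Q Q (shift (x + y)) = distr (distr Q Q (shift y)) Q (shift x)"
      by (subst distr_distr) (auto simp: shift_shift comp_def)
    then show ?thesis using that by (simp add: G_def)
  qed
  have zero: "0 \<in> G"
    using distr_id2[of Q Q] by (simp add: G_def shift_def[abs_def] id_def)
  have minus: "- x \<in> G" if "x \<in> G" for x
  proof -
    have "distr Q Q (shift (- x)) = distr (distr Q Q (shift x)) Q (shift (- x))"
      using that by (simp add: G_def)
    also have "\<dots> = distr Q Q (shift (- x + x))"
      by (subst distr_distr) (auto simp: shift_shift comp_def)
    finally show ?thesis using zero by (simp add: G_def)
  qed
  have axis: "axis i 1 \<in> G" for i
    using stationary[of i] by (simp add: G_def invariant_under_def)
  have nat: "int n *s axis i 1 \<in> G" for n i
  proof (induction n)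
    case (Suc n)
    have "int (Suc n) *s axis i 1 = axis i 1 + int n *s axis i (1 :: int)"
      by (simp add: vec_eq_iff algebra_simps)
    then show ?case using add[OF axis Suc.IH] by simp
  qed (simp add: zero)
  have scale: "z *s axis i 1 \<in> G" for z i
  proof (cases z)
    case (nonneg n)
    then show ?thesis using nat by simp
  next
    case (neg n)
    have "z *s axis i 1 = - (int (Suc n) *s axis i (1 :: int))"
      by (simp add: neg vec_eq_iff algebra_simps)
    then show ?thesis by (simp only: minus[OF nat])
  qed
  have "finite F \<Longrightarrow> (\<Sum>i\<in>F. (x $ i) *s axis i 1) \<in> G" for F
    by (induction F rule: finite_induct) (simp_all add: zero add scale)
  then have "x \<in> G" using basis_expansion[of x] by (metis finite_class.finite_UNIV)
  then show ?thesis by (simp add: G_def)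
qed

lemma emeasure_shift:
  assumes "{\<omega>. P \<omega>} \<in> sets Q"
  shows "emeasure Q {\<omega>. P (shift x \<omega>)} = emeasure Q {\<omega>. P \<omega>}"
proof -
  have "emeasure Q {\<omega>. P \<omega>} = emeasure (distr Q Q (shift x)) {\<omega>. P \<omega>}" by (simp add: distr_shift)
  also have "\<dots> = emeasure Q {\<omega>. P (shift x \<omega>)}"
    using assms by (subst emeasure_distr) (auto simp: space_Q vimage_def)
  finally show ?thesis ..
qed

lemma AE_shift:
  assumes "AE \<omega> in Q. P \<omega>"
  shows "AE \<omega> in Q. P (shift x \<omega>)"
proof (rule AE_distrD[OF measurable_shift])
  show "AE \<omega> in distr Q Q (shift x). P \<omega>" unfolding distr_shift by (rule assms)
qed

lemma sets_gap_gt: "{\<omega>. \<omega> 0 \<and> enat n < first_point e \<omega>} \<in> sets Q"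
proof -
  have "{\<omega> \<in> space Q. \<omega> 0 \<and> (\<forall>k. 0 < k \<and> k \<le> n \<longrightarrow> \<not> \<omega> (int k *s e))} \<in> sets Q" by measurable
  then show ?thesis by (simp add: space_Q first_point_gt_iff)
qed

lemma measurable_first_point [measurable]: "first_point e \<in> measurable Q (count_space UNIV)"
proof (subst measurable_count_space_eq2_countable)
  have gt: "{\<omega> \<in> space Q. enat n < first_point e \<omega>} \<in> sets Q" for n
    unfolding first_point_gt_iff by measurable
  have "first_point e -` {a} \<inter> space Q \<in> sets Q" for a
  proof (cases a)
    case (enat k)
    have "{\<omega> \<in> space Q. 0 < k \<and> \<omega> (int k *s e) \<and> (\<forall>j. 0 < j \<and> j < k \<longrightarrow> \<not> \<omega> (int j *s e))} \<in> sets Q" by measurable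
    also have "{\<omega> \<in> space Q. 0 < k \<and> \<omega> (int k *s e) \<and> (\<forall>j. 0 < j \<and> j < k \<longrightarrow> \<not> \<omega> (int j *s e))} = first_point e -` {a} \<inter> space Q"
      by (auto simp: enat first_point_eq_iff)
    finally show ?thesis .
  next
    case infinity
    have "first_point e -` {a} \<inter> space Q = (\<Inter>n. {\<omega> \<in> space Q. enat n < first_point e \<omega>})"
    proof -
      have "first_point e \<omega> = \<infinity> \<longleftrightarrow> (\<forall>n. enat n < first_point e \<omega>)" for \<omega>
        by (cases "first_point e \<omega>") auto
      then show ?thesis unfolding infinity by (auto simp: space_Q)
    qed
    then show ?thesis using gt by auto
  qed
  then show "first_point e \<in> space Q \<rightarrow> UNIV \<and> (\<forall>a\<in>UNIV. first_point e -` {a} \<inter> space Q \<in> sets Q)" by simp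
qed

lemma sets_gap: "{\<omega>. \<omega> x \<and> first_point e (shift x \<omega>) = enat k} \<in> sets Q"
proof -
  have "{\<omega> \<in> space Q. \<omega> x \<and> first_point e (shift x \<omega>) = enat k} \<in> sets Q" by measurable
  then show ?thesis by (simp add: space_Q)
qed

lemma sets_origin: "{\<omega>. \<omega> 0} \<in> sets Q"
proof -
  have "{\<omega> \<in> space Q. \<omega> 0} \<in> sets Q" by measurable
  then show ?thesis by (simp add: space_Q)
qed

lemma emeasure_gap: "emeasure Q {\<omega>. \<omega> x \<and> first_point e (shift x \<omega>) = enat k} = gap_prob Q e k"
proof -
  have "{\<omega>. \<omega> 0 \<and> first_point e \<omega> = enat k} \<in> sets Q"
    using sets_gap[of 0 e k] by (simp add: shift_def)
  from emeasure_shift[OF this, of x] show ?thesis by (simp add: gap_prob_def shift_def[of x])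
qed

text \<open>Viewed from its far end a gap points backwards, and stationarity moves that end to the
  origin. This extends the gap condition to the negative directions.\<close>

lemma gap_prob_minus: "gap_prob Q (- e) k = gap_prob Q e k"
proof -
  have "gap_prob Q e k = emeasure Q {\<omega>. \<omega> (0 + int k *s e) \<and> first_point (- e) (shift (0 + int k *s e) \<omega>) = enat k}"
    unfolding emeasure_gap[of 0 e k, symmetric] first_point_reverse_iff[of _ 0 e k] ..
  then show ?thesis by (simp only: emeasure_gap)
qed

text \<open>One half of Kac's formula: after a shift, the event that there is a point at the origin and
  the next gap exceeds \<open>n\<close> says that \<open>- n e\<close> is the last point before or at the origin.\<close>

lemma nn_integral_gap_le_1:
  "(\<integral>\<^sup>+\<omega>. ennreal_of_enat (first_point e \<omega>) * indicator {\<omega>. \<omega> 0} \<omega> \<partial>Q) \<le> 1"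
proof -
  define B where "B n = {\<omega>. shift (- (int n *s e)) \<omega> 0 \<and> enat n < first_point e (shift (- (int n *s e)) \<omega>)}" for n
  have "(\<integral>\<^sup>+\<omega>. ennreal_of_enat (first_point e \<omega>) * indicator {\<omega>. \<omega> 0} \<omega> \<partial>Q) =
      (\<integral>\<^sup>+\<omega>. ennreal_of_enat (if \<omega> 0 then first_point e \<omega> else 0) \<partial>Q)"
    by (rule nn_integral_cong) (auto simp: indicator_def)
  also have "\<dots> = (\<Sum>n. emeasure Q {\<omega> \<in> space Q. enat n < (if \<omega> 0 then first_point e \<omega> else 0)})"
    by (subst nn_integral_enat_function) measurable
  also have "\<dots> = (\<Sum>n. emeasure Q {\<omega>. \<omega> 0 \<and> enat n < first_point e \<omega>})"
    by (intro suminf_cong arg_cong[where f = "emeasure Q"]) (auto simp: space_Q)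
  also have "\<dots> = (\<Sum>n. emeasure Q (B n))"
    unfolding B_def by (intro suminf_cong emeasure_shift[symmetric] sets_gap_gt)
  also have "\<dots> = emeasure Q (\<Union>n. B n)"
  proof (rule suminf_emeasure)
    have "B n \<in> sets Q" for n
    proof -
      have "{\<omega> \<in> space Q. shift (- (int n *s e)) \<omega> 0 \<and> enat n < first_point e (shift (- (int n *s e)) \<omega>)} \<in> sets Q"
        unfolding first_point_gt_iff shift_def by measurable
      then show ?thesis by (simp add: B_def space_Q)
    qed
    then show "range B \<subseteq> sets Q" by auto
    \<comment> \<open>On \<open>B n\<close> the sites \<open>- (n - 1) e\<close> to \<open>0\<close>
      are empty, whereas \<open>B m\<close> puts a point at \<open>- m e\<close>, which is
      \<open>n - m\<close> steps after \<open>- n e\<close>.\<close>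
    have "B m \<inter> B n = {}" if "m < n" for m n
    proof -
      have "- (int n *s e) + int (n - m) *s e = - (int m *s e)"
        using that by (simp add: vec_eq_iff of_nat_diff algebra_simps)
      then show ?thesis
        using that unfolding B_def first_point_gt_iff shift_def
        by (auto dest!: spec[of _ "n - m"])
    qed
    then show "disjoint_family B"
      unfolding disjoint_family_on_def by (metis Int_commute nat_neq_iff)
  qed
  also have "\<dots> \<le> 1" by (rule emeasure_le_1)
  finally show ?thesis .
qed

text \<open>The gap has finite integral over the configurations with a point at the origin, hence is
  finite there almost surely; shifts and countability cover all sites and directions.\<close>

lemma AE_no_dead_end: "AE \<omega> in Q. no_dead_end \<omega>"
proof -
  have "AE \<omega> in Q. \<omega> x \<longrightarrow> first_point e (shift x \<omega>) \<noteq> \<infinity>" for e x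
  proof -
    have "(\<integral>\<^sup>+\<omega>. ennreal_of_enat (first_point e \<omega>) * indicator {\<omega>. \<omega> 0} \<omega> \<partial>Q) \<noteq> \<infinity>"
      using nn_integral_gap_le_1[of e] by (auto simp: top_unique)
    then have "AE \<omega> in Q. ennreal_of_enat (first_point e \<omega>) * indicator {\<omega>. \<omega> 0} \<omega> \<noteq> \<infinity>"
      using sets_origin by (intro nn_integral_PInf_AE) measurable
    then have "AE \<omega> in Q. \<omega> 0 \<longrightarrow> first_point e \<omega> \<noteq> \<infinity>"
    proof eventually_elim
      case (elim \<omega>)
      then show ?case by (cases "first_point e \<omega>") (auto simp: indicator_def)
    qed
    from AE_shift[OF this, of x] show ?thesis by (simp add: shift_def)
  qed
  then have "AE \<omega> in Q. \<forall>e x. \<omega> x \<longrightarrow> first_point e (shift x \<omega>) \<noteq> \<infinity>"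
    by (simp add: AE_all_countable)
  then show ?thesis by eventually_elim (auto simp: no_dead_end_def)
qed

text \<open>Otherwise stationarity would make every site empty almost surely, against the assumption
  on the empty configuration.\<close>

lemma emeasure_origin_pos: "emeasure Q {\<omega>. \<omega> 0} \<noteq> 0"
proof
  assume "emeasure Q {\<omega>. \<omega> 0} = 0"
  then have "AE \<omega> in Q. \<not> \<omega> 0"
    using sets_origin by (subst AE_iff_measurable[where N = "{\<omega>. \<omega> 0}"]) (auto simp: space_Q)
  then have "AE \<omega> in Q. \<not> \<omega> x" for x
    using AE_shift[of "\<lambda>\<omega>. \<not> \<omega> 0" x] by (simp add: shift_def)
  then have "AE \<omega> in Q. \<forall>x. \<not> \<omega> x" by (simp add: AE_all_countable)
  then have "AE \<omega> in Q. points \<omega> = {}" by eventually_elim (auto simp: points_def)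
  moreover have "{\<omega> \<in> space Q. points \<omega> = {}} \<in> sets Q"
  proof -
    have "{\<omega> \<in> space Q. \<forall>x. \<not> \<omega> x} \<in> sets Q" by measurable
    then show ?thesis by (simp add: points_def)
  qed
  ultimately have "\<P>(\<omega> in Q. points \<omega> = {}) = 1" by (simp add: prob_Collect_eq_1)
  then show False using not_as_empty by simp
qed

section \<open>The Palm measure and the gap condition\<close>

lemma palm_eq: "palm Q = uniform_measure Q {\<omega>. \<omega> 0}"
  by (simp add: palm_def space_Q)

lemma AE_palmI: "AE \<omega> in Q. \<omega> 0 \<longrightarrow> P \<omega> \<Longrightarrow> AE \<omega> in palm Q. P \<omega>"
  unfolding palm_eq by (rule AE_uniform_measureI[OF sets_origin]) simp

lemma space_palm: "space (palm Q) = UNIV"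
  by (simp add: palm_eq space_Q)

lemma mean_gap_eq:
  "mean_gap Q i = (\<integral>\<^sup>+\<omega>. ennreal_of_enat (first_point (axis i 1) \<omega>) * indicator {\<omega>. \<omega> 0} \<omega> \<partial>Q) / emeasure Q {\<omega>. \<omega> 0}"
  unfolding mean_gap_def palm_eq by (rule nn_integral_uniform_measure) (use sets_origin in measurable)

lemma emeasure_palm_gap:
  "emeasure (palm Q) {\<omega>. first_point e \<omega> = enat k} = gap_prob Q e k / emeasure Q {\<omega>. \<omega> 0}"
proof -
  have "{\<omega> \<in> space Q. first_point e \<omega> = enat k} \<in> sets Q" by measurable
  then have "emeasure (palm Q) {\<omega>. first_point e \<omega> = enat k} = emeasure Q ({\<omega>. \<omega> 0} \<inter> {\<omega>. first_point e \<omega> = enat k}) / emeasure Q {\<omega>. \<omega> 0}"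
    unfolding palm_eq by (intro emeasure_uniform_measure sets_origin) (simp add: space_Q)
  then show ?thesis by (simp add: gap_prob_def Int_def)
qed

text \<open>Returning from \<open>palm Q\<close> to \<open>Q\<close> multiplies by the density of
  points, which Kac's inequality bounds by the inverse mean gap, exactly the normalisation in
  \<open>gap_tail\<close>.\<close>

lemma weighted_gap_tail_le: "(\<Sum>j. of_nat (N + j) * gap_prob Q (axis i 1) (N + j)) \<le> gap_tail Q i N"
  unfolding gap_tail_def
proof (rule suminf_le)
  fix j
  let ?p = "emeasure Q {\<omega>. \<omega> 0}"
  have p: "?p \<noteq> 0" "?p \<noteq> \<infinity>" using emeasure_origin_pos by (simp_all add: emeasure_eq_measure)
  have cancel: "?p * (a / ?p) = a" for a
    using mult_divide_eq_ennreal[of ?p a] p by (simp add: ennreal_times_divide mult.commute)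
  have "?p * mean_gap Q i \<le> 1"
    unfolding mean_gap_eq cancel by (rule nn_integral_gap_le_1)
  then have *: "?p \<le> inverse (mean_gap Q i)" by (rule ennreal_mult_le_1D)
  let ?P = "emeasure (palm Q) {\<omega> \<in> space (palm Q). first_point (axis i 1) \<omega> = enat (N + j)}"
  have "gap_prob Q (axis i 1) (N + j) = ?p * ?P"
    by (simp only: space_palm emeasure_palm_gap cancel UNIV_I simp_thms)
  then have "of_nat (N + j) * gap_prob Q (axis i 1) (N + j) = of_nat (N + j) * ?P * ?p"
    by (simp only: mult_ac)
  also have "\<dots> \<le> of_nat (N + j) * ?P * inverse (mean_gap Q i)" by (rule mult_left_mono[OF *]) simp
  finally show "of_nat (N + j) * gap_prob Q (axis i 1) (N + j) \<le> of_nat (N + j) * ?P / mean_gap Q i"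
    by (simp only: divide_ennreal_def)
qed simp_all

lemma gap_condition_weighted_tail:
  assumes "gap_condition Q"
  obtains C where "0 < C"
    "\<And>e N. e \<in> unit_steps \<Longrightarrow> 1 \<le> N \<Longrightarrow> (\<Sum>j. of_nat (N + j) * gap_prob Q e (N + j)) \<le> ennreal (C / real N)"
proof -
  obtain C where C: "0 < C" "\<And>i N. 1 \<le> N \<Longrightarrow> gap_tail Q i N \<le> ennreal (C / real N)"
    using assms by (auto simp: gap_condition_def)
  show ?thesis
  proof
    fix e :: "int ^ 'd" and N :: nat
    assume e: "e \<in> unit_steps" and N: "1 \<le> N"
    obtain i where "e = axis i 1 \<or> e = - axis i 1" using e unfolding unit_steps_def by blast
    then have "gap_prob Q e = gap_prob Q (axis i 1)" by (auto simp: fun_eq_iff gap_prob_minus)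
    then show "(\<Sum>j. of_nat (N + j) * gap_prob Q e (N + j)) \<le> ennreal (C / real N)"
      using order_trans[OF weighted_gap_tail_le C(2)[OF N]] by simp
  qed (rule C(1))
qed

text \<open>For \<open>k \<ge> N\<close> one has \<open>N * k \<le> k^2\<close>, so \<open>N\<close>
  times the tail is at most the second moment; dividing by the mean only helps, since every gap is
  at least 1.\<close>

lemma gap_condition_if_second_moment:
  assumes "\<And>i. (\<integral>\<^sup>+\<omega>. (ennreal_of_enat (first_point (axis i 1) \<omega>))\<^sup>2 \<partial>palm Q) < \<infinity>"
  shows "gap_condition Q"
proof -
  interpret P: prob_space "palm Q"
    unfolding palm_eq by (rule prob_space_uniform_measure[OF emeasure_origin_pos]) (simp add: emeasure_eq_measure)
  define M where "M i = (\<integral>\<^sup>+\<omega>. (ennreal_of_enat (first_point (axis i 1) \<omega>))\<^sup>2 \<partial>palm Q)" for i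
  have meas [measurable]: "first_point e \<in> measurable (palm Q) (count_space UNIV)" for e
    using measurable_first_point[of e] by (simp add: palm_eq)
  have mean: "1 \<le> mean_gap Q i" for i
  proof -
    have "1 \<le> ennreal_of_enat (first_point (axis i 1) \<omega>)" for \<omega>
    proof -
      have "0 < first_point (axis i 1) \<omega>"
        using first_point_gt_iff[of 0 "axis i 1" \<omega>] by (simp add: enat_0)
      then have "1 \<le> first_point (axis i 1) \<omega>"
        using ileI1[of 0 "first_point (axis i 1) \<omega>"] by (simp only: one_eSuc)
      then show ?thesis
        using ennreal_of_enat_le_iff[of 1 "first_point (axis i 1) \<omega>"] by (simp only: ennreal_of_enat_1)
    qed
    then have "(\<integral>\<^sup>+\<omega>. 1 \<partial>palm Q) \<le> mean_gap Q i"
      unfolding mean_gap_def by (intro nn_integral_mono)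
    then show ?thesis by (simp add: P.emeasure_space_1)
  qed
  have tail: "gap_tail Q i N \<le> M i / of_nat N" if N: "1 \<le> N" for i N
  proof -
    let ?f = "first_point (axis i 1)"
    let ?A = "\<lambda>k. {\<omega> \<in> space (palm Q). ?f \<omega> = enat k}"
    have A: "?A k \<in> sets (palm Q)" for k by measurable
    have "of_nat N * gap_tail Q i N \<le> of_nat N * (\<Sum>j. of_nat (N + j) * emeasure (palm Q) (?A (N + j)))"
      unfolding gap_tail_def
    proof (intro mult_left_mono suminf_le)
      fix j
      have "inverse (mean_gap Q i) \<le> 1" by (rule inverse_ennreal_le_1[OF mean])
      then show "of_nat (N + j) * emeasure (palm Q) (?A (N + j)) / mean_gap Q i
          \<le> of_nat (N + j) * emeasure (palm Q) (?A (N + j))"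
        using mult_left_mono[of "inverse (mean_gap Q i)" 1 "of_nat (N + j) * emeasure (palm Q) (?A (N + j))"]
        by (simp add: divide_ennreal_def)
    qed simp_all
    also have "\<dots> = (\<Sum>j. of_nat N * of_nat (N + j) * emeasure (palm Q) (?A (N + j)))"
      by (simp add: mult.assoc)
    also have "\<dots> = (\<Sum>j. \<integral>\<^sup>+\<omega>. of_nat N * of_nat (N + j) * indicator (?A (N + j)) \<omega> \<partial>palm Q)"
      using A by (simp add: nn_integral_cmult_indicator)
    also have "\<dots> = (\<integral>\<^sup>+\<omega>. (\<Sum>j. of_nat N * of_nat (N + j) * indicator (?A (N + j)) \<omega>) \<partial>palm Q)"
      using A by (intro nn_integral_suminf[symmetric]) measurable
    also have "\<dots> \<le> M i"
      unfolding M_def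
    proof (rule nn_integral_mono)
      fix \<omega>
      show "(\<Sum>j. of_nat N * of_nat (N + j) * indicator (?A (N + j)) \<omega>) \<le> (ennreal_of_enat (?f \<omega>))\<^sup>2"
      proof (cases "\<exists>m. ?f \<omega> = enat (N + m)")
        case True
        then obtain m where m: "?f \<omega> = enat (N + m)" by blast
        define g :: "nat \<Rightarrow> ennreal" where "g j = of_nat N * of_nat (N + j) * indicator (?A (N + j)) \<omega>" for j
        have "(\<Sum>j. g j) = (\<Sum>j\<in>{m}. g j)"
          by (rule suminf_finite) (auto simp: g_def m indicator_def)
        also have "\<dots> = g m" by simp
        also have "\<dots> \<le> of_nat N * of_nat (N + m)" by (auto simp: g_def indicator_def)
        also have "\<dots> \<le> of_nat (N + m) * of_nat (N + m)" by (rule mult_right_mono) (auto simp del: of_nat_add)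
        finally show ?thesis by (simp add: g_def m power2_eq_square)
      next
        case False
        then have "indicator (?A (N + j)) \<omega> = (0 :: ennreal)" for j by (auto simp: indicator_def)
        then show ?thesis by simp
      qed
    qed
    finally have *: "of_nat N * gap_tail Q i N \<le> M i" .
    have "of_nat N \<noteq> (0 :: ennreal)" "of_nat N \<noteq> (top :: ennreal)" using N by auto
    then have "gap_tail Q i N = of_nat N * gap_tail Q i N / of_nat N"
      using mult_divide_eq_ennreal[of "of_nat N" "gap_tail Q i N"] by (simp add: mult.commute)
    also have "\<dots> \<le> M i / of_nat N" by (rule divide_right_mono_ennreal[OF *])
    finally show ?thesis .
  qed
  \<comment> \<open>The sum dominates the second moments of all directions at once, and the extra 1
    keeps the constant positive.\<close>
  define C where "C = 1 + (\<Sum>i\<in>UNIV. enn2real (M i))"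
  have "M i \<le> ennreal C" for i
  proof -
    have "M i = ennreal (enn2real (M i))" using assms[of i] by (simp add: M_def)
    also have "enn2real (M i) \<le> (\<Sum>i\<in>UNIV. enn2real (M i))" by (rule member_le_sum) auto
    then have "ennreal (enn2real (M i)) \<le> ennreal C" by (intro ennreal_leI) (simp add: C_def)
    finally show ?thesis .
  qed
  moreover have "C > 0" unfolding C_def by (intro add_pos_nonneg sum_nonneg) auto
  ultimately have "gap_tail Q i N \<le> ennreal (C / real N)" if "1 \<le> N" for i N
  proof -
    have "gap_tail Q i N \<le> M i / of_nat N" by (rule tail[OF that])
    also have "\<dots> \<le> ennreal C / of_nat N" by (intro divide_right_mono_ennreal \<open>M i \<le> ennreal C\<close>)
    also have "\<dots> = ennreal (C / real N)"
      using that \<open>C > 0\<close> by (simp add: divide_ennreal[symmetric] ennreal_of_nat_eq_real_of_nat)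
    finally show ?thesis .
  qed
  with \<open>C > 0\<close> show ?thesis unfolding gap_condition_def by blast
qed

text \<open>By stationarity the probability of a gap of length \<open>k\<close> is the same at every
  site and factors out of the sum over \<open>x\<close>; the rest is Tonelli.\<close>

lemma expected_random_energy:
  "(\<integral>\<^sup>+\<omega>. random_energy e f \<omega> \<partial>Q) =
   (\<integral>\<^sup>+k. gap_prob Q e k * (\<integral>\<^sup>+x. ennreal ((f x - f (x + int k *s e))\<^sup>2) \<partial>count_space UNIV) \<partial>count_space UNIV)"
proof -
  let ?I = "\<lambda>x k. indicator {\<omega>. \<omega> x \<and> first_point e (shift x \<omega>) = enat k} :: 'd config \<Rightarrow> ennreal"
  let ?g = "\<lambda>x k. ennreal ((f x - f (x + int k *s e))\<^sup>2)"
  have I [measurable]: "?I x k \<in> borel_measurable Q" for x k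
    using sets_gap by (rule borel_measurable_indicator)
  have inner: "(\<lambda>\<omega>. \<integral>\<^sup>+k. ?I x k \<omega> * ?g x k \<partial>count_space UNIV) \<in> borel_measurable Q" for x
    by (subst nn_integral_count_space_nat) measurable
  have "(\<integral>\<^sup>+\<omega>. random_energy e f \<omega> \<partial>Q) =
      (\<integral>\<^sup>+x. \<integral>\<^sup>+\<omega>. \<integral>\<^sup>+k. ?I x k \<omega> * ?g x k \<partial>count_space UNIV \<partial>Q \<partial>count_space UNIV)"
    unfolding random_energy_def by (rule nn_integral_count_space_nn_integral) (simp_all add: inner)
  also have "\<dots> = (\<integral>\<^sup>+x. \<integral>\<^sup>+k. \<integral>\<^sup>+\<omega>. ?I x k \<omega> * ?g x k \<partial>Q \<partial>count_space UNIV \<partial>count_space UNIV)"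
    by (intro nn_integral_cong nn_integral_count_space_nn_integral) simp_all
  also have "\<dots> = (\<integral>\<^sup>+x. \<integral>\<^sup>+k. gap_prob Q e k * ?g x k \<partial>count_space UNIV \<partial>count_space UNIV)"
    by (intro nn_integral_cong) (simp add: nn_integral_multc nn_integral_indicator sets_gap emeasure_gap)
  also have "\<dots> = (\<integral>\<^sup>+k. \<integral>\<^sup>+x. gap_prob Q e k * ?g x k \<partial>count_space UNIV \<partial>count_space UNIV)"
    by (rule nn_integral_count_space_nn_integral) simp_all
  also have "\<dots> = (\<integral>\<^sup>+k. gap_prob Q e k * (\<integral>\<^sup>+x. ?g x k \<partial>count_space UNIV) \<partial>count_space UNIV)"
    by (intro nn_integral_cong nn_integral_cmult) simp
  finally show ?thesis .
qed

lemma measurable_random_energy [measurable]: "random_energy e f \<in> borel_measurable Q"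
proof -
  let ?I = "\<lambda>x k. indicator {\<omega>. \<omega> x \<and> first_point e (shift x \<omega>) = enat k} :: 'd config \<Rightarrow> ennreal"
  have [measurable]: "?I x k \<in> borel_measurable Q" for x k
    using sets_gap by (rule borel_measurable_indicator)
  have [measurable]: "(\<lambda>\<omega>. \<integral>\<^sup>+k. ?I x k \<omega> * ennreal ((f x - f (x + int k *s e))\<^sup>2) \<partial>count_space UNIV) \<in> borel_measurable Q" for x
    by (subst nn_integral_count_space_nat) measurable
  \<comment> \<open>Enumerating the lattice by naturals turns the integral over sites into a series
    of measurable functions.\<close>
  have bij: "bij_betw from_nat (range (to_nat :: int ^ 'd \<Rightarrow> nat)) (UNIV :: (int ^ 'd) set)"
    by (rule bij_betwI[of _ _ _ to_nat]) auto
  show ?thesis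
    unfolding random_energy_def[abs_def] nn_integral_bij_count_space[OF bij, symmetric]
    by (subst nn_integral_count_space_indicator, simp, subst nn_integral_count_space_nat, measurable)
qed

end

section \<open>Test functions of small energy\<close>

definition tent :: "nat \<Rightarrow> int ^ 2 \<Rightarrow> real" where
  "tent r x = max 0 (1 - real_of_int (max \<bar>x $ 1\<bar> \<bar>x $ 2\<bar>) / real r)"

definition open_square :: "nat \<Rightarrow> (int ^ 2) set" where
  "open_square r = {x. \<bar>x $ 1\<bar> < int r \<and> \<bar>x $ 2\<bar> < int r}"

lemma tent_origin: "r > 0 \<Longrightarrow> tent r 0 = 1"
  by (simp add: tent_def)

lemma tent_nonneg: "0 \<le> tent r x" and tent_le_1: "tent r x \<le> 1"
  by (simp_all add: tent_def)

lemma tent_eq_0: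
  assumes "r > 0" "x \<notin> open_square r"
  shows "tent r x = 0"
proof -
  have "int r \<le> max \<bar>x $ 1\<bar> \<bar>x $ 2\<bar>" using assms(2) by (auto simp: open_square_def)
  then have "real r \<le> real_of_int (max \<bar>x $ 1\<bar> \<bar>x $ 2\<bar>)" by linarith
  then show ?thesis using assms(1) by (simp add: tent_def)
qed

lemma finite_open_square: "finite (open_square r)" and card_open_square: "card (open_square r) \<le> 4 * r\<^sup>2"
proof -
  let ?J = "{- int r + 1..int r - 1}"
  let ?h = "\<lambda>x :: int ^ 2. (x $ 1, x $ 2)"
  have inj: "inj_on ?h (open_square r)" by (auto simp: inj_on_def vec_eq_iff forall_2)
  have im: "?h ` open_square r \<subseteq> ?J \<times> ?J" by (auto simp: open_square_def)
  have fin: "finite (?J \<times> ?J)" by simp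
  show "finite (open_square r)"
    using finite_imageD[OF finite_subset[OF im fin] inj] .
  have "card (open_square r) = card (?h ` open_square r)" by (rule card_image[OF inj, symmetric])
  also have "\<dots> \<le> card (?J \<times> ?J)" by (rule card_mono[OF fin im])
  also have "\<dots> = nat (2 * int r - 1) * nat (2 * int r - 1)" by (simp add: card_cartesian_product)
  also have "\<dots> \<le> (2 * r) * (2 * r)" by (intro mult_le_mono) linarith+
  finally show "card (open_square r) \<le> 4 * r\<^sup>2" by (simp add: power2_eq_square)
qed

lemma tent_lipschitz:
  assumes "r > 0" "e \<in> unit_steps"
  shows "\<bar>tent r x - tent r (x + int k *s e)\<bar> \<le> real k / real r"
proof -
  have e: "\<bar>e $ i\<bar> \<le> 1" for i
    using assms(2) by (auto simp: unit_steps_def axis_def)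
  have *: "\<bar>\<bar>x $ i\<bar> - \<bar>(x + int k *s e) $ i\<bar>\<bar> \<le> int k" for i
  proof -
    have "\<bar>int k * e $ i\<bar> \<le> int k * 1" unfolding abs_mult by (intro mult_mono) (use e[of i] in auto)
    then show ?thesis by simp
  qed
  let ?n = "\<lambda>x :: int ^ 2. max \<bar>x $ 1\<bar> \<bar>x $ 2\<bar>"
  have max_int: "\<bar>max a b - max c d\<bar> \<le> l" if "\<bar>a - c\<bar> \<le> l" "\<bar>b - d\<bar> \<le> l" for a b c d l :: int
    using that by linarith
  have max_real: "\<bar>max 0 (1 - u) - max 0 (1 - v)\<bar> \<le> \<bar>u - v\<bar>" for u v :: real
    by linarith
  have "\<bar>?n x - ?n (x + int k *s e)\<bar> \<le> int k"
    by (rule max_int[OF * *])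
  then have "\<bar>real_of_int (?n x) - real_of_int (?n (x + int k *s e))\<bar> \<le> real k" by linarith
  then have "\<bar>real_of_int (?n x) - real_of_int (?n (x + int k *s e))\<bar> / real r \<le> real k / real r"
    by (rule divide_right_mono) simp
  moreover have "\<bar>tent r x - tent r (x + int k *s e)\<bar> \<le>
      \<bar>real_of_int (?n x) / real r - real_of_int (?n (x + int k *s e)) / real r\<bar>"
    unfolding tent_def by (rule max_real)
  moreover have "\<bar>real_of_int (?n x) / real r - real_of_int (?n (x + int k *s e)) / real r\<bar> =
      \<bar>real_of_int (?n x) - real_of_int (?n (x + int k *s e))\<bar> / real r"
    unfolding diff_divide_distrib[symmetric] by (simp only: abs_divide abs_of_nat)
  ultimately show ?thesis by linarith
qed

text \<open>The product of increments vanishes unless an end of the edge lies in the square of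
  radius \<open>r\<close>, which leaves at most \<open>8 * r^2\<close> sites. There the first factor
  is at most \<open>min 1 (k / r)\<close> and the second at most \<open>k / r'\<close>.\<close>

lemma nn_integral_tent_cross:
  assumes r: "0 < r" and r': "0 < r'" and e: "e \<in> unit_steps"
  shows "(\<integral>\<^sup>+x. ennreal (\<bar>tent r x - tent r (x + int k *s e)\<bar> * \<bar>tent r' x - tent r' (x + int k *s e)\<bar>) \<partial>count_space UNIV)
    \<le> ennreal (8 * (real r / real r') * (real k * real (min r k)))"
proof -
  define F where "F = open_square r \<union> (\<lambda>x. x - int k *s e) ` open_square r"
  define c where "c = min 1 (real k / real r) * (real k / real r')"
  have c: "c \<ge> 0" by (simp add: c_def)
  have finF: "finite F" by (simp add: F_def finite_open_square)
  have cardF: "card F \<le> 8 * r\<^sup>2"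
    using card_Un_le[of "open_square r" "(\<lambda>x. x - int k *s e) ` open_square r"] card_image_le[OF finite_open_square, of "\<lambda>x. x - int k *s e" r]
      card_open_square[of r] unfolding F_def by linarith
  have le: "\<bar>tent r x - tent r (x + int k *s e)\<bar> * \<bar>tent r' x - tent r' (x + int k *s e)\<bar> \<le> c * indicator F x" for x
  proof (cases "x \<in> F")
    case True
    have "\<bar>tent r x - tent r (x + int k *s e)\<bar> \<le> 1"
      using tent_nonneg[of r x] tent_le_1[of r x] tent_nonneg[of r "x + int k *s e"] tent_le_1[of r "x + int k *s e"]
      by linarith
    then have "\<bar>tent r x - tent r (x + int k *s e)\<bar> * \<bar>tent r' x - tent r' (x + int k *s e)\<bar> \<le> c"
      unfolding c_def using tent_lipschitz[OF r e, of x k]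
      by (intro mult_mono tent_lipschitz[OF r' e]) simp_all
    then show ?thesis using True by simp
  next
    case False
    have "x + int k *s e \<notin> open_square r"
    proof
      assume "x + int k *s e \<in> open_square r"
      then have "(x + int k *s e) - int k *s e \<in> F" unfolding F_def by blast
      then show False using False by simp
    qed
    moreover have "x \<notin> open_square r" using False by (simp add: F_def)
    ultimately show ?thesis using False by (simp add: tent_eq_0[OF r])
  qed
  have "(\<integral>\<^sup>+x. ennreal (\<bar>tent r x - tent r (x + int k *s e)\<bar> * \<bar>tent r' x - tent r' (x + int k *s e)\<bar>) \<partial>count_space UNIV)
      \<le> (\<integral>\<^sup>+x. ennreal c * indicator F x \<partial>count_space UNIV)"
  proof (intro nn_integral_mono)
    fix x
    have "ennreal (c * indicator F x) = ennreal c * indicator F x" by (simp add: indicator_def)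
    then show "ennreal (\<bar>tent r x - tent r (x + int k *s e)\<bar> * \<bar>tent r' x - tent r' (x + int k *s e)\<bar>) \<le> ennreal c * indicator F x"
      using ennreal_leI[OF le[of x]] by (simp only:)
  qed
  also have "\<dots> = ennreal c * of_nat (card F)"
    by (subst nn_integral_cmult_indicator) (simp_all add: finF)
  also have "\<dots> = ennreal (c * real (card F))"
    using c by (simp add: ennreal_mult ennreal_of_nat_eq_real_of_nat)
  also have "\<dots> \<le> ennreal (8 * (real r / real r') * (real k * real (min r k)))"
  proof (rule ennreal_leI)
    have "c * real (card F) \<le> c * (8 * (real r)\<^sup>2)"
      using cardF c by (intro mult_left_mono) (simp_all add: of_nat_power[symmetric] del: of_nat_power)
    also have "\<dots> = 8 * (real r / real r') * (real k * (real r * min 1 (real k / real r)))"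
      by (simp add: c_def power2_eq_square)
    also have "real r * min 1 (real k / real r) = real (min r k)"
      using r by (simp add: min_def field_simps)
    finally show "c * real (card F) \<le> 8 * (real r / real r') * (real k * real (min r k))" .
  qed
  finally show ?thesis .
qed

section \<open>Logarithmic growth and summation over scales\<close>

lemma harm_power_two_le: "harm (2 ^ m) \<le> (1 + real m :: real)"
proof (induction m)
  case (Suc m)
  have "harm (2 ^ Suc m) = harm (2 ^ m) + (\<Sum>k\<in>{2 ^ m<..2 ^ Suc m}. inverse (real k))"
  proof -
    have "{1..2 ^ Suc m} = {1..2 ^ m} \<union> {2 ^ m<..2 ^ Suc m :: nat}" by auto
    then show ?thesis unfolding harm_def by (simp add: sum.union_disjoint ivl_disj_int)
  qed
  also have "(\<Sum>k\<in>{2 ^ m<..2 ^ Suc m}. inverse (real k)) \<le> (\<Sum>k\<in>{2 ^ m<..2 ^ Suc m :: nat}. inverse (2 ^ m))"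
  proof (rule sum_mono)
    fix k :: nat assume "k \<in> {2 ^ m<..2 ^ Suc m}"
    then have "real (2 ^ m) \<le> real k" by (intro of_nat_mono) simp
    then show "inverse (real k) \<le> inverse (2 ^ m)" by (intro le_imp_inverse_le) simp_all
  qed
  also have "\<dots> = 1" by simp
  finally show ?case using Suc by simp
qed (simp add: harm_def)

text \<open>\<open>min r k\<close> counts the \<open>N\<close> in \<open>{1..r}\<close> with
  \<open>N \<le> k\<close>, so exchanging sums yields \<open>r\<close> tails, the
  \<open>N\<close>-th at most \<open>C / N\<close>. The truncation at \<open>r\<close> leaves a
  harmonic number where the full second moment may be infinite.\<close>

lemma nn_integral_weighted_min:
  fixes q :: "nat \<Rightarrow> ennreal" and C :: real
  assumes C: "0 < C" and tail: "\<And>N. 1 \<le> N \<Longrightarrow> (\<Sum>j. of_nat (N + j) * q (N + j)) \<le> ennreal (C / real N)"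
  shows "(\<integral>\<^sup>+k. q k * ennreal (real k * real (min r k)) \<partial>count_space UNIV) \<le> ennreal (C * harm r)"
proof -
  have "q k * ennreal (real k * real (min r k)) = (\<Sum>N\<in>{1..r}. of_nat k * q k * indicator {N..} k)" for k
  proof -
    have "(\<Sum>N\<in>{1..r}. indicator {N..} k) = (of_nat (card ({1..r} \<inter> {N. N \<le> k})) :: ennreal)"
      by (simp add: indicator_def sum.If_cases)
    also have "{1..r} \<inter> {N. N \<le> k} = {1..min r k}" by auto
    finally show ?thesis
      by (simp add: sum_distrib_left[symmetric] ennreal_mult ennreal_of_nat_eq_real_of_nat mult_ac)
  qed
  then have "(\<integral>\<^sup>+k. q k * ennreal (real k * real (min r k)) \<partial>count_space UNIV) =
      (\<Sum>N\<in>{1..r}. \<integral>\<^sup>+k. of_nat k * q k * indicator {N..} k \<partial>count_space UNIV)"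
    by (simp only:) (rule nn_integral_sum, simp)
  also have "\<dots> \<le> (\<Sum>N\<in>{1..r}. ennreal (C / real N))"
  proof (rule sum_mono)
    fix N assume N: "N \<in> {1..r}"
    have bij: "bij_betw (\<lambda>j. N + j) UNIV {N..}"
      by (rule bij_betwI[of _ _ _ "\<lambda>k. k - N"]) auto
    have "(\<integral>\<^sup>+k. of_nat k * q k * indicator {N..} k \<partial>count_space UNIV) =
        (\<integral>\<^sup>+k. of_nat k * q k \<partial>count_space {N..})"
      by (rule nn_integral_count_space_indicator[symmetric]) simp
    also have "\<dots> = (\<integral>\<^sup>+j. of_nat (N + j) * q (N + j) \<partial>count_space UNIV)"
      by (rule nn_integral_bij_count_space[OF bij, symmetric])
    also have "\<dots> = (\<Sum>j. of_nat (N + j) * q (N + j))" by (rule nn_integral_count_space_nat)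
    also have "\<dots> \<le> ennreal (C / real N)" using N by (intro tail) simp
    finally show "(\<integral>\<^sup>+k. of_nat k * q k * indicator {N..} k \<partial>count_space UNIV) \<le> ennreal (C / real N)" .
  qed
  also have "\<dots> = ennreal (\<Sum>N\<in>{1..r}. C / real N)" using C by (intro sum_ennreal) simp
  also have "(\<Sum>N\<in>{1..r}. C / real N) = C * harm r"
    by (simp add: harm_def sum_distrib_left divide_inverse)
  finally show ?thesis .
qed

text \<open>In truncated subtraction the exponent is the distance of \<open>m\<close> and
  \<open>n\<close>, so two geometric series, each at most 2, dominate the sum.\<close>

lemma sum_half_power_distance_le: "(\<Sum>n<M. (1 / 2 :: real) ^ ((m - n) + (n - m))) \<le> 4"
proof -
  have geo: "(\<Sum>j<n. (1 / 2 :: real) ^ j) \<le> 2" for n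
    by (simp add: sum_gp_strict)
  have "(\<Sum>n<M. (1 / 2 :: real) ^ ((m - n) + (n - m))) \<le>
      (\<Sum>n\<in>{..m} \<union> {m..<M + m}. (1 / 2) ^ ((m - n) + (n - m)))"
    by (rule sum_mono2) auto
  also have "\<dots> \<le> (\<Sum>n\<in>{..m}. (1 / 2) ^ ((m - n) + (n - m))) + (\<Sum>n\<in>{m..<M + m}. (1 / 2) ^ ((m - n) + (n - m)))"
    by (subst sum.union_inter[symmetric]) (auto intro!: sum_nonneg)
  also have "(\<Sum>n\<in>{..m}. (1 / 2 :: real) ^ ((m - n) + (n - m))) = (\<Sum>j<Suc m. (1 / 2) ^ j)"
    by (rule sum.reindex_bij_witness[of _ "\<lambda>j. m - j" "\<lambda>n. m - n"]) auto
  also have "(\<Sum>n\<in>{m..<M + m}. (1 / 2 :: real) ^ ((m - n) + (n - m))) = (\<Sum>j<M. (1 / 2) ^ j)"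
    by (rule sum.reindex_bij_witness[of _ "\<lambda>j. m + j" "\<lambda>n. n - m"]) auto
  finally show ?thesis using geo[of "Suc m"] geo[of M] by linarith
qed

text \<open>The factor \<open>harm M\<close> makes the weights sum to 1. Then the sum of
  \<open>(weight M m)^2 * (m + 1)\<close> over \<open>m < M\<close> is
  \<open>1 / harm M\<close>.\<close>

definition weight :: "nat \<Rightarrow> nat \<Rightarrow> real" where
  "weight M m = 1 / (real (Suc m) * harm M)"

text \<open>At distance about \<open>2 ^ j\<close> its value is roughly
  \<open>1 - log j / log M\<close>: the profile decays like an iterated logarithm of the
  distance.\<close>

definition log_tent :: "nat \<Rightarrow> int ^ 2 \<Rightarrow> real" where
  "log_tent M x = (\<Sum>m<M. weight M m * tent (2 ^ m) x)"

lemma harm_eq_lessThan: "harm M = (\<Sum>m<M. 1 / real (Suc m))"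
  unfolding harm_def by (rule sum.reindex_bij_witness[of _ Suc "\<lambda>k. k - 1"]) (auto simp: divide_inverse)

lemma weight_nonneg: "weight M m \<ge> 0"
  by (simp add: weight_def harm_nonneg)

lemma log_tent_origin:
  assumes "M > 0"
  shows "log_tent M 0 = 1"
proof -
  have "log_tent M 0 = (\<Sum>m<M. 1 / real (Suc m)) / harm M"
    by (simp add: log_tent_def tent_origin weight_def sum_divide_distrib)
  also have "\<dots> = harm M / harm M" by (simp only: harm_eq_lessThan)
  also have "\<dots> = 1"
    by (rule divide_self) (rule less_imp_neq[OF harm_pos[OF assms], symmetric])
  finally show ?thesis .
qed

lemma fin_supp_log_tent: "fin_supp (log_tent M)"
proof (rule finite_subset)
  show "{x. log_tent M x \<noteq> 0} \<subseteq> (\<Union>m<M. open_square (2 ^ m))"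
  proof
    fix x assume "x \<in> {x. log_tent M x \<noteq> 0}"
    then have "(\<Sum>m<M. weight M m * tent (2 ^ m) x) \<noteq> 0" by (simp add: log_tent_def)
    then obtain m where "m \<in> {..<M}" "weight M m * tent (2 ^ m) x \<noteq> 0" by (rule sum.not_neutral_contains_not_neutral)
    then show "x \<in> (\<Union>m<M. open_square (2 ^ m))" using tent_eq_0[of "2 ^ m" x] by auto
  qed
qed (simp add: finite_open_square)

text \<open>The smaller scale governs: its harmonic number gives \<open>1 + m\<close>, and the ratio
  of the radii gives the decay in \<open>n - m\<close>.\<close>

lemma log_tent_cross:
  assumes e: "e \<in> unit_steps" and m: "m \<le> n"
    and C: "0 < C" and tail: "\<And>N. 1 \<le> N \<Longrightarrow> (\<Sum>j. of_nat (N + j) * q (N + j)) \<le> ennreal (C / real N)"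
  shows "(\<integral>\<^sup>+k. q k * (\<integral>\<^sup>+x. ennreal (\<bar>tent (2 ^ m) x - tent (2 ^ m) (x + int k *s e)\<bar> *
      \<bar>tent (2 ^ n) x - tent (2 ^ n) (x + int k *s e)\<bar>) \<partial>count_space UNIV) \<partial>count_space UNIV)
    \<le> ennreal (8 * C * (1 + real m) * (1 / 2) ^ (n - m))"
proof -
  have half: "real (2 ^ m) / real (2 ^ n) = (1 / 2) ^ (n - m)"
    using m by (simp add: power_divide power_diff)
  have "(\<integral>\<^sup>+k. q k * (\<integral>\<^sup>+x. ennreal (\<bar>tent (2 ^ m) x - tent (2 ^ m) (x + int k *s e)\<bar> *
      \<bar>tent (2 ^ n) x - tent (2 ^ n) (x + int k *s e)\<bar>) \<partial>count_space UNIV) \<partial>count_space UNIV)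
    \<le> (\<integral>\<^sup>+k. q k * ennreal (8 * (real (2 ^ m) / real (2 ^ n)) * (real k * real (min (2 ^ m) k))) \<partial>count_space UNIV)"
    by (intro nn_integral_mono mult_left_mono nn_integral_tent_cross[OF _ _ e]) simp_all
  also have "\<dots> = (\<integral>\<^sup>+k. ennreal (8 * (1 / 2) ^ (n - m)) * (q k * ennreal (real k * real (min (2 ^ m) k))) \<partial>count_space UNIV)"
  proof (rule nn_integral_cong)
    fix k
    have "ennreal (8 * (1 / 2) ^ (n - m) * (real k * real (min (2 ^ m) k))) =
       ennreal (8 * (1 / 2) ^ (n - m)) * ennreal (real k * real (min (2 ^ m) k))"
      by (rule ennreal_mult) simp_all
    then show "q k * ennreal (8 * (real (2 ^ m) / real (2 ^ n)) * (real k * real (min (2 ^ m) k))) =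
        ennreal (8 * (1 / 2) ^ (n - m)) * (q k * ennreal (real k * real (min (2 ^ m) k)))"
      unfolding half by (simp only: mult_ac)
  qed
  also have "\<dots> = ennreal (8 * (1 / 2) ^ (n - m)) * (\<integral>\<^sup>+k. q k * ennreal (real k * real (min (2 ^ m) k)) \<partial>count_space UNIV)"
    by (rule nn_integral_cmult) simp
  also have "\<dots> \<le> ennreal (8 * (1 / 2) ^ (n - m)) * ennreal (C * harm (2 ^ m))"
    by (intro mult_left_mono nn_integral_weighted_min[OF C tail]) simp_all
  also have "\<dots> = ennreal (8 * (1 / 2) ^ (n - m) * (C * harm (2 ^ m)))"
    using C by (intro ennreal_mult[symmetric]) (simp_all add: harm_nonneg)
  also have "\<dots> \<le> ennreal (8 * (1 / 2) ^ (n - m) * (C * (1 + real m)))"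
    using C by (intro ennreal_leI mult_left_mono harm_power_two_le) simp_all
  also have "8 * (1 / 2) ^ (n - m) * (C * (1 + real m)) = 8 * C * (1 + real m) * (1 / 2) ^ (n - m)"
    by simp
  finally show ?thesis .
qed

text \<open>The scales \<open>2 ^ m\<close> are almost orthogonal for the expected energy form, and scale \<open>m\<close>
  contributes \<open>(weight M m)\<^sup>2 * (m + 1)\<close> up to constants; the weights minimise the total.\<close>

lemma log_tent_energy:
  assumes M: "M > 0" and e: "e \<in> unit_steps"
    and C: "0 < C" and tail: "\<And>N. 1 \<le> N \<Longrightarrow> (\<Sum>j. of_nat (N + j) * q (N + j)) \<le> ennreal (C / real N)"
  shows "(\<integral>\<^sup>+k. q k * (\<integral>\<^sup>+x. ennreal ((log_tent M x - log_tent M (x + int k *s e))\<^sup>2) \<partial>count_space UNIV) \<partial>count_space UNIV)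
    \<le> ennreal (32 * C / harm M)"
proof -
  define D where "D m k x = tent (2 ^ m) x - tent (2 ^ m) (x + int k *s e)" for m k x
  define I where "I m n = (\<integral>\<^sup>+k. q k * (\<integral>\<^sup>+x. ennreal (\<bar>D m k x\<bar> * \<bar>D n k x\<bar>) \<partial>count_space UNIV) \<partial>count_space UNIV)" for m n
  have I: "I m n \<le> ennreal (8 * C * (1 + real (min m n)) * (1 / 2) ^ ((m - n) + (n - m)))" for m n
  proof (cases "m \<le> n")
    case True
    then show ?thesis using log_tent_cross[OF e True C tail] by (simp add: I_def D_def)
  next
    case False
    then have "n \<le> m" by simp
    then show ?thesis
      using log_tent_cross[OF e \<open>n \<le> m\<close> C tail] unfolding I_def D_def
      by (simp add: mult.commute[of "\<bar>tent (2 ^ m) _ - _\<bar>"])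
  qed
  \<comment> \<open>Absolute values discard cancellation between scales but permit working in
    \<open>ennreal\<close>; the decay of the cross terms suffices.\<close>
  have sq: "ennreal ((log_tent M x - log_tent M (x + int k *s e))\<^sup>2) \<le>
      (\<Sum>m<M. \<Sum>n<M. ennreal (weight M m * weight M n) * ennreal (\<bar>D m k x\<bar> * \<bar>D n k x\<bar>))" for k x
  proof -
    have "log_tent M x - log_tent M (x + int k *s e) = (\<Sum>m<M. weight M m * D m k x)"
      by (simp add: log_tent_def D_def sum_subtractf right_diff_distrib)
    then have "(log_tent M x - log_tent M (x + int k *s e))\<^sup>2 =
        (\<Sum>m<M. \<Sum>n<M. (weight M m * weight M n) * (D m k x * D n k x))"
      by (simp add: power2_eq_square sum_product mult_ac)
    also have "\<dots> \<le> (\<Sum>m<M. \<Sum>n<M. (weight M m * weight M n) * (\<bar>D m k x\<bar> * \<bar>D n k x\<bar>))"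
      by (intro sum_mono mult_left_mono) (simp_all add: weight_nonneg abs_mult[symmetric])
    finally have "ennreal ((log_tent M x - log_tent M (x + int k *s e))\<^sup>2) \<le>
        ennreal (\<Sum>m<M. \<Sum>n<M. (weight M m * weight M n) * (\<bar>D m k x\<bar> * \<bar>D n k x\<bar>))"
      by (rule ennreal_leI)
    also have "\<dots> = (\<Sum>m<M. \<Sum>n<M. ennreal ((weight M m * weight M n) * (\<bar>D m k x\<bar> * \<bar>D n k x\<bar>)))"
      by (subst sum_ennreal[symmetric]) (auto intro!: sum_nonneg mult_nonneg_nonneg sum.cong sum_ennreal[symmetric] simp: weight_nonneg)
    finally show ?thesis by (simp only: ennreal_mult weight_nonneg mult_nonneg_nonneg abs_ge_zero)
  qed
  have "(\<integral>\<^sup>+k. q k * (\<integral>\<^sup>+x. ennreal ((log_tent M x - log_tent M (x + int k *s e))\<^sup>2) \<partial>count_space UNIV) \<partial>count_space UNIV)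
      \<le> (\<integral>\<^sup>+k. q k * (\<integral>\<^sup>+x. (\<Sum>m<M. \<Sum>n<M. ennreal (weight M m * weight M n) * ennreal (\<bar>D m k x\<bar> * \<bar>D n k x\<bar>)) \<partial>count_space UNIV) \<partial>count_space UNIV)"
    by (intro nn_integral_mono mult_left_mono sq) simp
  also have "\<dots> = (\<Sum>m<M. \<Sum>n<M. ennreal (weight M m * weight M n) * I m n)"
  proof -
    have "(\<integral>\<^sup>+k. q k * (a * J k) \<partial>count_space UNIV) = a * (\<integral>\<^sup>+k. q k * J k \<partial>count_space UNIV)" for a J
      by (subst nn_integral_cmult[symmetric]) (simp_all add: mult.left_commute)
    then show ?thesis by (simp add: nn_integral_sum nn_integral_cmult sum_distrib_left I_def)
  qed
  also have "\<dots> \<le> (\<Sum>m<M. \<Sum>n<M. ennreal (8 * C / harm M * weight M m * (1 / 2) ^ ((m - n) + (n - m))))"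
  proof (intro sum_mono)
    fix m n
    have "ennreal (weight M m * weight M n) * I m n \<le>
        ennreal (weight M m * weight M n) * ennreal (8 * C * (1 + real (min m n)) * (1 / 2) ^ ((m - n) + (n - m)))"
      by (rule mult_left_mono[OF I]) simp
    also have "\<dots> = ennreal (weight M m * weight M n * (8 * C * (1 + real (min m n)) * (1 / 2) ^ ((m - n) + (n - m))))"
      using C by (intro ennreal_mult[symmetric] mult_nonneg_nonneg weight_nonneg) simp_all
    also have "\<dots> \<le> ennreal (8 * C / harm M * weight M m * (1 / 2) ^ ((m - n) + (n - m)))"
    proof (rule ennreal_leI)
      \<comment> \<open>The weight of one scale absorbs the cost of the pair, leaving
        \<open>1 / harm M\<close> times the weight of the other.\<close>
      have "weight M n * (1 + real (min m n)) \<le> weight M n * real (Suc n)"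
        by (intro mult_left_mono weight_nonneg) simp
      also have "\<dots> = 1 / harm M" by (simp add: weight_def)
      finally have "(8 * C * weight M m * (1 / 2) ^ ((m - n) + (n - m))) * (weight M n * (1 + real (min m n))) \<le>
          (8 * C * weight M m * (1 / 2) ^ ((m - n) + (n - m))) * (1 / harm M)"
        using C by (intro mult_left_mono mult_nonneg_nonneg weight_nonneg) simp_all
      then show "weight M m * weight M n * (8 * C * (1 + real (min m n)) * (1 / 2) ^ ((m - n) + (n - m))) \<le>
          8 * C / harm M * weight M m * (1 / 2) ^ ((m - n) + (n - m))"
        by (simp only: divide_inverse mult_ac mult_1_left)
    qed
    finally show "ennreal (weight M m * weight M n) * I m n \<le> ennreal (8 * C / harm M * weight M m * (1 / 2) ^ ((m - n) + (n - m)))" .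
  qed
  also have "\<dots> = ennreal (\<Sum>m<M. \<Sum>n<M. 8 * C / harm M * weight M m * (1 / 2) ^ ((m - n) + (n - m)))"
  proof -
    have nn: "0 \<le> 8 * C / harm M * weight M m * (1 / 2) ^ ((m - n) + (n - m))" for m n
      using C by (intro mult_nonneg_nonneg divide_nonneg_nonneg weight_nonneg harm_nonneg) simp_all
    have "(\<Sum>n<M. ennreal (8 * C / harm M * weight M m * (1 / 2) ^ ((m - n) + (n - m)))) =
        ennreal (\<Sum>n<M. 8 * C / harm M * weight M m * (1 / 2) ^ ((m - n) + (n - m)))" for m
      by (rule sum_ennreal) (rule nn)
    moreover have "(\<Sum>m<M. ennreal (\<Sum>n<M. 8 * C / harm M * weight M m * (1 / 2) ^ ((m - n) + (n - m)))) =
        ennreal (\<Sum>m<M. \<Sum>n<M. 8 * C / harm M * weight M m * (1 / 2) ^ ((m - n) + (n - m)))"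
      by (rule sum_ennreal) (intro sum_nonneg nn)
    ultimately show ?thesis by (simp only:)
  qed
  \<comment> \<open>The factor 32 is 8 from the cross terms times 4 from the sum over the distance
    of scales.\<close>
  also have "\<dots> \<le> ennreal (32 * C / harm M)"
  proof (rule ennreal_leI)
    have "(\<Sum>m<M. \<Sum>n<M. 8 * C / harm M * weight M m * (1 / 2) ^ ((m - n) + (n - m))) =
        (\<Sum>m<M. 8 * C / harm M * weight M m * (\<Sum>n<M. (1 / 2) ^ ((m - n) + (n - m))))"
      by (simp only: sum_distrib_left)
    also have "\<dots> \<le> (\<Sum>m<M. 8 * C / harm M * weight M m * 4)"
      using C by (intro sum_mono mult_left_mono sum_half_power_distance_le mult_nonneg_nonneg
        divide_nonneg_nonneg weight_nonneg harm_nonneg) simp_all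
    also have "\<dots> = 32 * C / harm M * (\<Sum>m<M. weight M m)"
      unfolding sum_distrib_left by (rule sum.cong) simp_all
    also have "(\<Sum>m<M. weight M m) = 1"
      using log_tent_origin[OF M] by (simp add: log_tent_def tent_origin)
    finally show "(\<Sum>m<M. \<Sum>n<M. 8 * C / harm M * weight M m * (1 / 2) ^ ((m - n) + (n - m))) \<le> 32 * C / harm M" by simp
  qed
  finally show ?thesis .
qed

section \<open>From vanishing expected energy to almost sure recurrence\<close>

theorem theorem1p7:
  fixes Q :: "2 config measure"
  assumes "ergodic_point_process Q"
  shows "(gap_condition Q \<longrightarrow> (AE \<omega> in palm Q. recurrent_walk \<omega>)) \<and>
         ((\<forall>i. (\<integral>\<^sup>+\<omega>. (ennreal_of_enat (first_point (axis i 1) \<omega>))\<^sup>2 \<partial>palm Q) < \<infinity>) \<longrightarrow>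
           gap_condition Q)"
proof (intro conjI impI)
  interpret ergodic_point_process Q by (rule assms)
  show "gap_condition Q"
    if "\<forall>i. (\<integral>\<^sup>+\<omega>. (ennreal_of_enat (first_point (axis i 1) \<omega>))\<^sup>2 \<partial>palm Q) < \<infinity>"
    using gap_condition_if_second_moment that by blast
  assume "gap_condition Q"
  then obtain C where C: "0 < C"
    "\<And>e N. e \<in> unit_steps \<Longrightarrow> 1 \<le> N \<Longrightarrow> (\<Sum>j. of_nat (N + j) * gap_prob Q e (N + j)) \<le> ennreal (C / real N)"
    by (rule gap_condition_weighted_tail) (rule that; assumption)
  \<comment> \<open>The index \<open>Suc n\<close> keeps the number of scales positive, so that the
    test function equals 1 at the origin.\<close>
  define F where "F n \<omega> = (\<Sum>e\<in>unit_steps. random_energy e (log_tent (Suc n)) \<omega>)" for n \<omega>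
  have F [measurable]: "F n \<in> borel_measurable Q" for n
    unfolding F_def by measurable
  have bound: "(\<integral>\<^sup>+\<omega>. F n \<omega> \<partial>Q) \<le> ennreal (128 * C / harm (Suc n))" for n
  proof -
    have "(\<integral>\<^sup>+\<omega>. F n \<omega> \<partial>Q) = (\<Sum>e\<in>unit_steps. \<integral>\<^sup>+\<omega>. random_energy e (log_tent (Suc n)) \<omega> \<partial>Q)"
      unfolding F_def by (rule nn_integral_sum) measurable
    also have "\<dots> \<le> (\<Sum>e\<in>(unit_steps :: (int ^ 2) set). ennreal (32 * C / harm (Suc n)))"
      unfolding expected_random_energy
      by (intro sum_mono log_tent_energy C) simp_all
    also have "\<dots> = ennreal (\<Sum>e\<in>(unit_steps :: (int ^ 2) set). 32 * C / harm (Suc n))"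
      using C(1) harm_nonneg[of "Suc n", where 'a = real] by (intro sum_ennreal) simp
    \<comment> \<open>In dimension two there are four directions, whence 128.\<close>
    also have "(\<Sum>e\<in>(unit_steps :: (int ^ 2) set). 32 * C / harm (Suc n)) = 128 * C / harm (Suc n)"
      by (simp add: card_unit_steps)
    finally show ?thesis .
  qed
  have "(\<lambda>n. 128 * C / harm (Suc n)) \<longlonglongrightarrow> 0"
    by (rule real_tendsto_divide_at_top[OF tendsto_const filterlim_compose[OF harm_at_top filterlim_Suc]])
  then have "(\<lambda>n. ennreal (128 * C / harm (Suc n))) \<longlonglongrightarrow> ennreal 0"
    by (rule tendsto_ennrealI)
  \<comment> \<open>The infimum lies below every \<open>F n\<close>, so its integral vanishes and no
    almost surely convergent subsequence has to be extracted.\<close>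
  moreover have "(\<integral>\<^sup>+\<omega>. (INF n. F n \<omega>) \<partial>Q) \<le> ennreal (128 * C / harm (Suc n))" for n
    by (rule order_trans[OF nn_integral_mono bound[of n]]) (rule INF_lower, simp)
  ultimately have "(\<integral>\<^sup>+\<omega>. (INF n. F n \<omega>) \<partial>Q) \<le> ennreal 0"
    by (intro LIMSEQ_le_const) blast+
  then have "AE \<omega> in Q. (INF n. F n \<omega>) = 0"
    by (subst nn_integral_0_iff_AE[symmetric]) simp_all
  with AE_no_dead_end have "AE \<omega> in Q. \<omega> 0 \<longrightarrow> recurrent_walk \<omega>"
  proof eventually_elim
    case (elim \<omega>)
    show ?case
    proof
      assume "\<omega> 0"
      show "recurrent_walk \<omega>"
      proof (rule recurrent_walk_if_small_energy[OF elim(1) \<open>\<omega> 0\<close>])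
        fix \<epsilon> :: real assume "\<epsilon> > 0"
        then have "(INF n. F n \<omega>) < ennreal \<epsilon>" using elim(2) by simp
        then obtain n where n: "F n \<omega> < ennreal \<epsilon>" by (auto simp: INF_less_iff)
        have "(\<Sum>e\<in>unit_steps. \<integral>\<^sup>+x. ennreal ((log_tent (Suc n) x - log_tent (Suc n) (jump \<omega> e x))\<^sup>2) \<partial>count_space UNIV) = F n \<omega>"
          unfolding F_def by (intro sum.cong refl jump_energy_eq_random_energy elim(1))
        with n show "\<exists>f. fin_supp f \<and> f 0 = 1 \<and>
            (\<Sum>e\<in>unit_steps. \<integral>\<^sup>+x. ennreal ((f x - f (jump \<omega> e x))\<^sup>2) \<partial>count_space UNIV) < ennreal \<epsilon>"
          by (intro exI[of _ "log_tent (Suc n)"] conjI fin_supp_log_tent log_tent_origin) simp_all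
      qed
    qed
  qed
  then show "AE \<omega> in palm Q. recurrent_walk \<omega>" by (rule AE_palmI)
qed

end
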